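(* Let $n$ and $r$ be nonnegative integers, and let $G$ be an $(n+r+2)$-connected graph. If the toughness of $G$ satisfies $t(G)>\frac{n+r+2}{2(r+2)}$, then $G$ is $(P_{\geq3},n)$-factor critical avoidable; that is, for every $W\subseteq V(G)$ with $|W|=n$ and every edge $e\in E(G-W)$, the graph $G-W-e$ has a $P_{\geq 3}$-factor.
   Context: All graphs are finite, undirected and simple. For $X\subseteq V(G)$, $G-X$ deletes the vertices of $X$; $G-e$ deletes edge $e$. $\omega(G)$ denotes the number of connected components of $G$. The toughness of $G$ is $t(G)=+\infty$ if $G$ is complete, and otherwise $t(G)=\min\{|X|/\omega(G-X): X\subseteq V(G),\ \omega(G-X)\geq 2\}$. A path factor of $G$ is a spanning subgraph every component of which is a path of order at least 2; for an integer $k\geq2$, a $P_{\geq k}$-factor is a path factor each of whose components has at least $k$ vertices. $G$ is $P_{\geq k}$-factor avoidable if for every $e\in E(G)$, $G$ has a $P_{\geq k}$-factor not containing $e$. $G$ is $(P_{\geq k},n)$-factor critical avoidable if for every $W\subseteq V(G)$ with $|W|=n$, $G-W$ is $P_{\geq k}$-factor avoidable. *)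

theory Defs
  imports Complex_Main "HOL-Library.Extended_Real"
begin

datatype 'a graph = Graph (verts: "'a set") (edges: "'a set set")

definition simple_graph :: "'a graph \<Rightarrow> bool" where
  "simple_graph G \<longleftrightarrow>
     finite (verts G) \<and> (\<forall>e\<in>edges G. e \<subseteq> verts G \<and> card e = 2)"

definition induced_subgraph :: "'a graph \<Rightarrow> 'a set \<Rightarrow> 'a graph" where
  "induced_subgraph G C = Graph (verts G \<inter> C) {e \<in> edges G. e \<subseteq> C}"

definition delete_verts :: "'a graph \<Rightarrow> 'a set \<Rightarrow> 'a graph" where
  "delete_verts G X = induced_subgraph G (verts G - X)"

definition delete_edge :: "'a graph \<Rightarrow> 'a set \<Rightarrow> 'a graph" where
  "delete_edge G e = Graph (verts G) (edges G - {e})"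

definition complete_graph :: "'a graph \<Rightarrow> bool" where
  "complete_graph G \<longleftrightarrow> (\<forall>u\<in>verts G. \<forall>v\<in>verts G. u \<noteq> v \<longrightarrow> {u, v} \<in> edges G)"

definition reach_rel :: "'a graph \<Rightarrow> ('a \<times> 'a) set" where
  "reach_rel G =
     {(u, v). u \<in> verts G \<and> v \<in> verts G \<and> (u, v) \<in> {(x, y). {x, y} \<in> edges G}\<^sup>*}"

definition components :: "'a graph \<Rightarrow> 'a set set" where
  "components G = verts G // reach_rel G"

definition num_components :: "'a graph \<Rightarrow> nat" where
  "num_components G = card (components G)"

definition connected_graph :: "'a graph \<Rightarrow> bool" where
  "connected_graph G \<longleftrightarrow> num_components G = 1"

definition k_connected :: "nat \<Rightarrow> 'a graph \<Rightarrow> bool" where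
  "k_connected k G \<longleftrightarrow>
     k < card (verts G) \<and>
     (\<forall>X. X \<subseteq> verts G \<and> card X < k \<longrightarrow> connected_graph (delete_verts G X))"

text \<open>For a finite simple graph that is not complete, the set in the second branch is finite, and
  it is nonempty: take \<open>X = verts G - {u, v}\<close> for nonadjacent \<open>u \<noteq> v\<close>.\<close>

definition toughness :: "'a graph \<Rightarrow> ereal" where
  "toughness G =
     (if complete_graph G then \<infinity>
      else Min {ereal (real (card X) / real (num_components (delete_verts G X))) |X.
                X \<subseteq> verts G \<and> 2 \<le> num_components (delete_verts G X)})"

definition path_graph :: "'a graph \<Rightarrow> bool" where
  "path_graph H \<longleftrightarrow>
     (\<exists>p. p \<noteq> [] \<and> distinct p \<and> verts H = set p \<and>
          edges H = {{p ! i, p ! Suc i} |i. Suc i < length p})"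

definition spanning_subgraph :: "'a graph \<Rightarrow> 'a graph \<Rightarrow> bool" where
  "spanning_subgraph F G \<longleftrightarrow> verts F = verts G \<and> edges F \<subseteq> edges G"

definition path_factor :: "'a graph \<Rightarrow> 'a graph \<Rightarrow> bool" where
  "path_factor F G \<longleftrightarrow>
     spanning_subgraph F G \<and>
     (\<forall>C\<in>components F. path_graph (induced_subgraph F C) \<and> 2 \<le> card C)"

definition path_ge_factor :: "nat \<Rightarrow> 'a graph \<Rightarrow> 'a graph \<Rightarrow> bool" where
  "path_ge_factor k F G \<longleftrightarrow> path_factor F G \<and> (\<forall>C\<in>components F. k \<le> card C)"

definition path_ge_factor_avoidable :: "nat \<Rightarrow> 'a graph \<Rightarrow> bool" where
  "path_ge_factor_avoidable k G \<longleftrightarrow>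
     (\<forall>e\<in>edges G. \<exists>F. path_ge_factor k F G \<and> e \<notin> edges F)"

definition path_ge_factor_critical_avoidable :: "nat \<Rightarrow> nat \<Rightarrow> 'a graph \<Rightarrow> bool" where
  "path_ge_factor_critical_avoidable k n G \<longleftrightarrow>
     (\<forall>W. W \<subseteq> verts G \<and> card W = n \<longrightarrow> path_ge_factor_avoidable k (delete_verts G W))"

end

theory Submission
  imports Defs
begin

text \<open>
  A \<open>P\<^sub>\<ge>\<^sub>3\<close>-factor of a connected graph \<open>H\<close> comes from a Kaneko-type theorem:
  if \<open>H - X\<close> has at most \<open>2|X|\<close> sun components for every nonempty \<open>X\<close>, then \<open>H\<close> has a factor or is
  itself a sun. For a graph without a factor, Hall's theorem excludes equality, and a set \<open>B\<close> leaving
  \<open>2|B| - 1\<close> suns consists of neighbours of leaves: otherwise a shared singleton component links two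
  vertices of \<open>B\<close> in one long path. Deleting an edge at a vertex that is neither a leaf nor the
  neighbour of a leaf then yields a smaller sun with two leaves at the same vertex, a contradiction.

  Toughness and connectivity bound the components of \<open>G - W - X\<close> by \<open>2|X| - 1\<close>, hence those of
  \<open>G - W - e - X\<close> by \<open>2|X|\<close>. Finally \<open>G - W - e\<close> is no sun: a sun of order at least three has three
  leaves, so one of them would already be a leaf of \<open>G - W\<close>, which is 2-connected.
\<close>

subsection \<open>Connected sets and components\<close>

text \<open>The factor 2 counts the suns that one path through a vertex of \<open>X\<close> can
  absorb: a sun can be entered at any of its vertices by a path that leaves a remainder with a
  factor. A vertex that receives only one sun still lies on a long enough path unless that sun is a
  single vertex, so singletons are the only obstacle for a set one below the bound. What matters is
  the deficit, \<open>2|X|\<close> minus the number of suns of \<open>H - X\<close>, for nonempty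
  \<open>X\<close>. Deleting an edge creates at most two additional suns, so a deficit of two or
  more survives the deletion. Deficit zero is impossible in a graph without a factor; the sets of
  deficit one therefore have to be understood before an edge can be removed inside the induction.
  The threshold for the toughness is the value of \<open>(n + x) / (2 * x)\<close> at
  \<open>x = r + 2\<close>, the least size of \<open>X\<close> at which connectivity no longer keeps
  \<open>G - W - X\<close> in one piece. The quotient does not increase with \<open>x\<close>, so
  this value also covers all larger sets.\<close>

definition conn :: "('a \<times> 'a) set \<Rightarrow> 'a set \<Rightarrow> bool" where
  "conn E C \<longleftrightarrow> (\<forall>A\<subseteq>C. A \<noteq> {} \<and> A \<noteq> C \<longrightarrow> (\<exists>x\<in>A. \<exists>y\<in>C - A. (x, y) \<in> E))"

text \<open>Described by closure in \<open>W\<close> rather than as reachability classes, a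
  component visibly stays one when vertices or edges are changed elsewhere. The relation may keep
  pairs outside \<open>W\<close>, so deleting vertices only changes the set.\<close>

definition comps :: "('a \<times> 'a) set \<Rightarrow> 'a set \<Rightarrow> 'a set set" where
  "comps E W = {C. C \<subseteq> W \<and> C \<noteq> {} \<and> conn E C \<and> (\<forall>x\<in>C. \<forall>y\<in>W - C. (x, y) \<notin> E)}"

lemma conn_crossing:
  assumes "conn E C" "A \<subseteq> C" "A \<noteq> {}" "A \<noteq> C"
  obtains x y where "x \<in> A" "y \<in> C - A" "(x, y) \<in> E"
  using assms unfolding conn_def by blast

lemma conn_mono:
  assumes "conn E C" "E \<inter> C \<times> C \<subseteq> E'"
  shows "conn E' C"
  unfolding conn_def
proof (intro allI impI)
  fix A assume A: "A \<subseteq> C" "A \<noteq> {} \<and> A \<noteq> C"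
  then obtain x y where "x \<in> A" "y \<in> C - A" "(x, y) \<in> E"
    using conn_crossing[OF assms(1)] by blast
  then show "\<exists>x\<in>A. \<exists>y\<in>C - A. (x, y) \<in> E'" using A(1) assms(2) by blast
qed

lemma compsD:
  assumes "C \<in> comps E W"
  shows "C \<subseteq> W" "C \<noteq> {}" "conn E C" "\<And>x y. x \<in> C \<Longrightarrow> y \<in> W \<Longrightarrow> (x, y) \<in> E \<Longrightarrow> y \<in> C"
  using assms unfolding comps_def by blast+

lemma compsI:
  assumes "C \<subseteq> W" "C \<noteq> {}" "conn E C" "\<And>x y. x \<in> C \<Longrightarrow> y \<in> W \<Longrightarrow> (x, y) \<in> E \<Longrightarrow> y \<in> C"
  shows "C \<in> comps E W"
  using assms unfolding comps_def by blast

lemma conn_singleton: "conn E {v}"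
  unfolding conn_def by blast

lemma comps_subset_closed:
  assumes "C \<in> comps E W" "A \<subseteq> W" "C \<inter> A \<noteq> {}"
    and "\<And>x y. x \<in> A \<Longrightarrow> y \<in> W \<Longrightarrow> (x, y) \<in> E \<Longrightarrow> y \<in> A"
  shows "C \<subseteq> A"
proof (rule ccontr)
  assume "\<not> C \<subseteq> A"
  then have "C \<inter> A \<noteq> C" by blast
  then obtain x y where "x \<in> C \<inter> A" "y \<in> C - C \<inter> A" "(x, y) \<in> E"
    using conn_crossing[OF compsD(3)[OF assms(1)], of "C \<inter> A"] assms(3) by blast
  then show False using assms(4) compsD(1)[OF assms(1)] by blast
qed

lemma comps_disjoint:
  assumes "C \<in> comps E W" "D \<in> comps E W" "C \<inter> D \<noteq> {}"
  shows "C = D"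
  using comps_subset_closed[OF assms(1) compsD(1)[OF assms(2)] assms(3)]
    comps_subset_closed[OF assms(2) compsD(1)[OF assms(1)]] compsD(4)[OF assms(1)]
    compsD(4)[OF assms(2)] assms(3) by blast

lemma finite_comps: "finite W \<Longrightarrow> finite (comps E W)"
  by (rule finite_subset[of _ "Pow W"]) (auto simp: comps_def)

text \<open>A closed set around \<open>v\<close> of least size is connected: if a cut had no
  crossing edge, both sides would be closed by symmetry, and one of them contains
  \<open>v\<close>.\<close>

lemma comps_cover:
  assumes "finite W" "sym E" "v \<in> W"
  obtains C where "C \<in> comps E W" "v \<in> C"
proof -
  define P where "P A \<longleftrightarrow> A \<subseteq> W \<and> v \<in> A \<and> (\<forall>x\<in>A. \<forall>y\<in>W - A. (x, y) \<notin> E)" for A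
  have "P W" unfolding P_def using assms by blast
  then obtain C where C: "P C" and min: "\<And>A. P A \<Longrightarrow> card C \<le> card A"
    using ex_has_least_nat[of P W card] by blast
  have fC: "finite C" using C assms(1) finite_subset unfolding P_def by blast
  have "conn E C" unfolding conn_def
  proof (intro allI impI, rule ccontr)
    fix A assume A: "A \<subseteq> C" "A \<noteq> {} \<and> A \<noteq> C" and no: "\<not> (\<exists>x\<in>A. \<exists>y\<in>C - A. (x, y) \<in> E)"
    have "P A \<or> P (C - A)"
      using no C A(1) symD[OF assms(2)] unfolding P_def by blast
    moreover have "card A < card C" "card (C - A) < card C"
      using A fC by (auto intro!: psubset_card_mono)
    ultimately show False using min by force
  qed
  then have "C \<in> comps E W" using C unfolding P_def comps_def by blast
  then show ?thesis using C that unfolding P_def by blast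
qed

lemma Union_comps: "finite W \<Longrightarrow> sym E \<Longrightarrow> \<Union> (comps E W) = W"
  using comps_cover compsD(1) by (metis Sup_le_iff UnionI subsetI subset_antisym)

lemma comps_conn:
  assumes "conn E W" "W \<noteq> {}"
  shows "comps E W = {W}"
proof -
  have W: "W \<in> comps E W" using assms by (intro compsI) auto
  have "C = W" if "C \<in> comps E W" for C
  proof (rule comps_disjoint[OF that W])
    show "C \<inter> W \<noteq> {}" using compsD(1,2)[OF that] by auto
  qed
  then show ?thesis using W by blast
qed

text \<open>Two uses share this form: deleting vertices inside \<open>R\<close> (with
  \<open>E' = E\<close>) and deleting an edge inside \<open>R\<close> (with
  \<open>R' = R\<close>).\<close>

lemma comps_replace:
  assumes "sym E" "R \<in> comps E W" "R' \<subseteq> R" "E' \<subseteq> E" "E \<inter> (W - R) \<times> (W - R) \<subseteq> E'"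
  shows "comps E' (W - R \<union> R') = (comps E W - {R}) \<union> comps E' R'"
proof (intro equalityI subsetI)
  note R = compsD[OF assms(2)]
  fix C assume C: "C \<in> comps E' (W - R \<union> R')"
  note C' = compsD[OF C]
  show "C \<in> (comps E W - {R}) \<union> comps E' R'"
  proof (cases "C \<inter> R' = {}")
    case True
    have "conn E C" using C'(3) assms(4) by (blast intro: conn_mono)
    moreover have "y \<in> C" if "x \<in> C" "y \<in> W" "(x, y) \<in> E" for x y
    proof -
      have "x \<in> W - R" using that C'(1) True by blast
      then have "y \<notin> R" using R(4) that symD[OF assms(1)] by blast
      then show ?thesis using that C'(4) assms(5) \<open>x \<in> W - R\<close> by blast
    qed
    ultimately have "C \<in> comps E W" using C'(1,2) True by (intro compsI) auto
    then show ?thesis using C'(1,2) True by blast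
  next
    case False
    have "C \<subseteq> R'"
      using comps_subset_closed[OF C, of R'] False R(1,4) assms(3,4) by blast
    then show ?thesis using C' by (intro UnI2 compsI) auto
  qed
next
  note R = compsD[OF assms(2)]
  fix C assume "C \<in> (comps E W - {R}) \<union> comps E' R'"
  then consider (1) "C \<in> comps E W" "C \<noteq> R" | (2) "C \<in> comps E' R'" by blast
  then show "C \<in> comps E' (W - R \<union> R')"
  proof cases
    case 1
    note C = compsD[OF 1(1)]
    have "C \<inter> R = {}" using comps_disjoint[OF 1(1) assms(2)] 1(2) by blast
    then have "C \<subseteq> W - R" using C(1) by blast
    moreover then have "conn E' C" using C(3) assms(5) by (blast intro: conn_mono)
    moreover have "y \<in> C" if "x \<in> C" "y \<in> W - R \<union> R'" "(x, y) \<in> E'" for x y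
      using that C(4)[of x y] assms(3,4) R(1) by blast
    ultimately show ?thesis using C(2) by (intro compsI) auto
  next
    case 2
    note C = compsD[OF 2]
    have "y \<in> C" if "x \<in> C" "y \<in> W - R \<union> R'" "(x, y) \<in> E'" for x y
      using that C(1) C(4)[of x y] R(4)[of x y] assms(3,4) by blast
    then show ?thesis using C(1-3) by (intro compsI) auto
  qed
qed

lemma Restr_subset_cong:
  assumes "E \<inter> W \<times> W = E' \<inter> W \<times> W" "C \<subseteq> W"
  shows "E \<inter> C \<times> C = E' \<inter> C \<times> C"
proof -
  have "C \<times> C = W \<times> W \<inter> C \<times> C" using assms(2) by auto
  then show ?thesis using assms(1) by (metis inf_assoc)
qed

lemma comps_cong:
  fixes E E' :: "('a \<times> 'a) set"
  assumes "E \<inter> W \<times> W = E' \<inter> W \<times> W"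
  shows "comps E W = comps E' W"
proof -
  have "comps F W \<subseteq> comps F' W" if "F \<inter> W \<times> W = F' \<inter> W \<times> W"
    for F F' :: "('a \<times> 'a) set"
  proof
    fix C assume C: "C \<in> comps F W"
    note C' = compsD[OF C]
    show "C \<in> comps F' W"
    proof (rule compsI)
      have "F \<inter> C \<times> C = F' \<inter> C \<times> C" by (rule Restr_subset_cong[OF that C'(1)])
      then show "conn F' C" using conn_mono[OF C'(3), of F'] by auto
      fix x y assume xy: "x \<in> C" "y \<in> W" "(x, y) \<in> F'"
      then have "(x, y) \<in> F' \<inter> W \<times> W" using C'(1) by blast
      then have "(x, y) \<in> F" unfolding that[symmetric] by simp
      then show "y \<in> C" using C'(4) xy by blast
    qed (fact C'(1) C'(2))+
  qed
  then show ?thesis using assms by (metis subset_antisym)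
qed

lemma comps_delete_verts:
  assumes "sym E" "R \<in> comps E W" "S \<subseteq> R"
  shows "comps E (W - S) = (comps E W - {R}) \<union> comps E (R - S)"
proof -
  have "W - S = W - R \<union> (R - S)" using compsD(1)[OF assms(2)] assms(3) by blast
  then show ?thesis using comps_replace[OF assms(1,2), of "R - S" E] by auto
qed

subsection \<open>Path factors\<close>

definition dpath :: "('a \<times> 'a) set \<Rightarrow> 'a list \<Rightarrow> bool" where
  "dpath E p \<longleftrightarrow> p \<noteq> [] \<and> distinct p \<and> successively (\<lambda>x y. (x, y) \<in> E) p"

text \<open>\<open>fac E V\<close> says that the graph induced by \<open>E\<close> on \<open>V\<close> has a \<open>P\<^sub>\<ge>\<^sub>3\<close>-factor.\<close>

inductive fac :: "('a \<times> 'a) set \<Rightarrow> 'a set \<Rightarrow> bool" for E where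
  fac_empty: "fac E {}"
| fac_path: "fac E V \<Longrightarrow> dpath E p \<Longrightarrow> 3 \<le> length p \<Longrightarrow> set p \<inter> V = {} \<Longrightarrow> fac E (set p \<union> V)"

lemma dpath_mono:
  assumes "dpath E p" "E \<inter> set p \<times> set p \<subseteq> E'"
  shows "dpath E' p"
proof -
  have "successively (\<lambda>x y. (x, y) \<in> E') p"
    unfolding successively_conv_nth
  proof (intro allI impI)
    fix i assume i: "Suc i < length p"
    then have "(p ! i, p ! Suc i) \<in> E"
      using assms(1) unfolding dpath_def successively_conv_nth by blast
    then show "(p ! i, p ! Suc i) \<in> E'" using assms(2) i by auto
  qed
  then show ?thesis using assms unfolding dpath_def by simp
qed

lemma dpath_rev: "sym E \<Longrightarrow> dpath E p \<Longrightarrow> dpath E (rev p)"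
  unfolding dpath_def by (auto simp: successively_rev sym_def elim: successively_mono)

lemma dpath_append:
  "dpath E p \<Longrightarrow> dpath E p' \<Longrightarrow> set p \<inter> set p' = {} \<Longrightarrow> (last p, hd p') \<in> E \<Longrightarrow> dpath E (p @ p')"
  unfolding dpath_def by (auto simp: successively_append_iff)

lemma dpath_single [simp]: "dpath E [v]"
  unfolding dpath_def by simp

lemma fac_mono: "fac E V \<Longrightarrow> E \<inter> V \<times> V \<subseteq> E' \<Longrightarrow> fac E' V"
proof (induction rule: fac.induct)
  case (fac_path V p)
  have "fac E' V" using fac_path by blast
  moreover have "dpath E' p" using fac_path.hyps(2) fac_path.prems by (auto intro: dpath_mono)
  ultimately show ?case using fac_path fac.fac_path by blast
qed (rule fac.fac_empty)

lemma fac_Un: "fac E V \<Longrightarrow> fac E V' \<Longrightarrow> V \<inter> V' = {} \<Longrightarrow> fac E (V \<union> V')"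
proof (induction rule: fac.induct)
  case (fac_path V p)
  then have "fac E (set p \<union> (V \<union> V'))" by (intro fac.fac_path) auto
  then show ?case by (simp add: Un_assoc)
qed simp

lemma fac_UN:
  assumes "finite I" "\<And>i. i \<in> I \<Longrightarrow> fac E (T i)"
    and "\<And>i j. i \<in> I \<Longrightarrow> j \<in> I \<Longrightarrow> i \<noteq> j \<Longrightarrow> T i \<inter> T j = {}"
  shows "fac E (\<Union>i\<in>I. T i)"
  using assms
proof (induction I rule: finite_induct)
  case (insert i I)
  have "T i \<inter> (\<Union>j\<in>I. T j) = {}" using insert.prems(2) insert.hyps(2) by blast
  then show ?case using insert by (auto intro: fac_Un)
qed (simp add: fac.fac_empty)

lemma fac_Union_comps:
  assumes "finite W" "K \<subseteq> comps E W" "\<And>C. C \<in> K \<Longrightarrow> fac E C"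
  shows "fac E (\<Union>K)"
proof -
  have "fac E (\<Union>C\<in>K. C)"
  proof (rule fac_UN)
    show "finite K" using finite_subset[OF assms(2) finite_comps[OF assms(1)]] .
    show "C \<inter> D = {}" if "C \<in> K" "D \<in> K" "C \<noteq> D" for C D
      using that assms(2) comps_disjoint[of C E W D] by blast
  qed (rule assms(3))
  then show ?thesis by simp
qed

lemma fac_path_through:
  "fac E V \<Longrightarrow> v \<in> V \<Longrightarrow> \<exists>p. dpath E p \<and> 3 \<le> length p \<and> v \<in> set p \<and> set p \<subseteq> V"
  by (induction rule: fac.induct) blast+

subsection \<open>Suns\<close>

definition nbrs :: "('a \<times> 'a) set \<Rightarrow> 'a set \<Rightarrow> 'a \<Rightarrow> 'a set" where
  "nbrs E V v = {u \<in> V. (v, u) \<in> E}"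

definition pendant :: "('a \<times> 'a) set \<Rightarrow> 'a set \<Rightarrow> 'a \<Rightarrow> 'a \<Rightarrow> bool" where
  "pendant E V q z \<longleftrightarrow> q \<in> V \<and> nbrs E V q = {z}"

lemma pendantD:
  assumes "pendant E V q z" "sym E" "irrefl E"
  shows "q \<in> V" "z \<in> V" "(q, z) \<in> E" "(z, q) \<in> E" "q \<noteq> z"
    "\<And>y. y \<in> V \<Longrightarrow> (q, y) \<in> E \<Longrightarrow> y = z"
proof -
  have "q \<in> V" "nbrs E V q = {z}" using assms(1) unfolding pendant_def by auto
  then show "q \<in> V" "z \<in> V" "(q, z) \<in> E" "\<And>y. y \<in> V \<Longrightarrow> (q, y) \<in> E \<Longrightarrow> y = z"
    unfolding nbrs_def by auto
  then show "(z, q) \<in> E" "q \<noteq> z" using symD[OF assms(2)] assms(3) unfolding irrefl_def by blast+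
qed

lemma pendantI:
  assumes "q \<in> V" "z \<in> V" "(q, z) \<in> E" "\<And>y. y \<in> V \<Longrightarrow> (q, y) \<in> E \<Longrightarrow> y = z"
  shows "pendant E V q z"
  using assms unfolding pendant_def nbrs_def by blast

text \<open>Only \<open>z\<close> is available next to \<open>q\<close>, so \<open>q\<close> is an
  end of its path, \<open>z\<close> comes second and \<open>t\<close> third. The conclusion
  \<open>z \<in> V\<close> also refutes factors of sets from which the only neighbour of
  \<open>q\<close> has been removed.\<close>

lemma fac_pendant:
  assumes "fac E V" "sym E" "q \<in> V" "nbrs E V q \<subseteq> {z}"
  obtains t where "t \<in> V" "t \<noteq> q" "t \<noteq> z" "(z, t) \<in> E" "z \<in> V"
proof -
  obtain p where p: "dpath E p" "3 \<le> length p" "q \<in> set p" "set p \<subseteq> V"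
    using fac_path_through[OF assms(1,3)] by blast
  obtain i where i: "i < length p" "q = p ! i" using p(3) by (metis in_set_conv_nth)
  have dis: "distinct p" and suc: "\<And>k. Suc k < length p \<Longrightarrow> (p ! k, p ! Suc k) \<in> E"
    using p(1) unfolding dpath_def by (auto simp: successively_conv_nth)
  have inV: "\<And>k. k < length p \<Longrightarrow> p ! k \<in> V" using p(4) nth_mem by blast
  have nb: "p ! k = z" if "k < length p" "(q, p ! k) \<in> E" for k
    using assms(4) that inV unfolding nbrs_def by blast
  show thesis
  proof (cases "i = 0")
    case True
    have e: "(p ! 0, p ! 1) \<in> E" "(p ! 1, p ! 2) \<in> E" using suc[of 0] suc[of 1] p(2) by (auto simp: numeral_2_eq_2)
    have "z = p ! 1" using nb[of 1] e True i p(2) by simp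
    moreover have "p ! 2 \<noteq> p ! 0" "p ! 2 \<noteq> p ! 1"
      using nth_eq_iff_index_eq[OF dis, of 2 0] nth_eq_iff_index_eq[OF dis, of 2 1] p(2) by linarith+
    ultimately show thesis using that[of "p ! 2"] e inV[of 2] inV[of 1] True i p(2) by auto
  next
    case False
    then obtain j where j: "i = Suc j" by (cases i) auto
    have zj: "z = p ! j" using nb[of j] suc[of j] i j symD[OF assms(2)] by auto
    \<comment> \<open>Otherwise both neighbours of \<open>q\<close> on the path would be
      \<open>z\<close>, against distinctness.\<close>
    have "Suc i = length p"
    proof (rule ccontr)
      assume "Suc i \<noteq> length p"
      then have "Suc i < length p" using i by simp
      then have "z = p ! Suc i" using nb[of "Suc i"] suc[of i] i by auto
      then show False using zj dis j i \<open>Suc i < length p\<close> by (auto simp: nth_eq_iff_index_eq)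
    qed
    then obtain k where k: "j = Suc k" using p(2) j by (cases j) auto
    have "(z, p ! k) \<in> E" using suc[of k] zj k i j symD[OF assms(2)] by auto
    moreover have "p ! k \<noteq> p ! i" "p ! k \<noteq> p ! j"
      using dis i j k by (auto simp: nth_eq_iff_index_eq)
    ultimately show thesis using that[of "p ! k"] zj i j k inV[of k] inV[of j] by auto
  qed
qed

text \<open>
  These are the suns of Kaneko: \<open>K\<^sub>1\<close>, \<open>K\<^sub>2\<close> and the coronas of factor-critical graphs. Factor-criticality
  is expressed by the possibility of starting a path of order two at any prescribed vertex and
  covering the rest by paths of order at least three.
\<close>

definition sun :: "('a \<times> 'a) set \<Rightarrow> 'a set \<Rightarrow> bool" where
  "sun E V \<longleftrightarrow> V \<noteq> {} \<and> conn E V \<and>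
     (\<forall>v\<in>V. V = {v} \<or> (\<exists>u\<in>V. u \<noteq> v \<and> (v, u) \<in> E \<and> fac E (V - {v, u}))) \<and>
     (3 \<le> card V \<longrightarrow>
        (\<forall>v\<in>V. \<exists>u. pendant E V v u \<or> pendant E V u v) \<and>
        (\<forall>z q q'. pendant E V q z \<and> pendant E V q' z \<longrightarrow> q = q'))"

definition suns :: "('a \<times> 'a) set \<Rightarrow> 'a set \<Rightarrow> 'a set set" where
  "suns E W = {C \<in> comps E W. sun E C}"

lemma sunD:
  assumes "sun E V"
  shows "V \<noteq> {}" "conn E V"
    and "\<And>v. v \<in> V \<Longrightarrow> V \<noteq> {v} \<Longrightarrow> \<exists>u\<in>V. u \<noteq> v \<and> (v, u) \<in> E \<and> fac E (V - {v, u})"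
    and "\<And>v. 3 \<le> card V \<Longrightarrow> v \<in> V \<Longrightarrow> \<exists>u. pendant E V v u \<or> pendant E V u v"
    and "\<And>z q q'. 3 \<le> card V \<Longrightarrow> pendant E V q z \<Longrightarrow> pendant E V q' z \<Longrightarrow> q = q'"
  using assms unfolding sun_def by blast+

lemma sun_singleton: "sun E {v}"
  unfolding sun_def by (auto simp: conn_singleton)

text \<open>Every clause of \<open>sun\<close> looks only at edges inside \<open>V\<close>.
  Agreement there is required in both directions, since additional edges can destroy pendant
  vertices.\<close>

lemma sun_mono:
  assumes "sun E V" "E \<inter> V \<times> V = E' \<inter> V \<times> V"
  shows "sun E' V"
proof -
  have agree: "(x, y) \<in> E \<longleftrightarrow> (x, y) \<in> E'" if "x \<in> V" "y \<in> V" for x y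
    using that assms(2) by (metis IntD1 IntI SigmaI)
  have "nbrs E V v = nbrs E' V v" if "v \<in> V" for v using that agree unfolding nbrs_def by blast
  then have pend: "pendant E V = pendant E' V" unfolding pendant_def by (auto simp: fun_eq_iff)
  have facE: "fac E' (V - A)" if "fac E (V - A)" for A
  proof (rule fac_mono[OF that])
    show "E \<inter> (V - A) \<times> (V - A) \<subseteq> E'" using agree by auto
  qed
  have flex: "\<exists>u\<in>V. u \<noteq> v \<and> (v, u) \<in> E' \<and> fac E' (V - {v, u})" if v: "v \<in> V" "V \<noteq> {v}" for v
  proof -
    obtain u where u: "u \<in> V" "u \<noteq> v" "(v, u) \<in> E" "fac E (V - {v, u})"
      using sunD(3)[OF assms(1) v] by blast
    have "(v, u) \<in> E'" using u(1,3) v(1) agree by blast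
    then show ?thesis using u facE[OF u(4)] by blast
  qed
  have "conn E' V" using sunD(2)[OF assms(1)] conn_mono[of E V E'] assms(2) by auto
  moreover have "\<forall>v\<in>V. V = {v} \<or> (\<exists>u\<in>V. u \<noteq> v \<and> (v, u) \<in> E' \<and> fac E' (V - {v, u}))"
    using flex by blast
  ultimately show ?thesis
    using assms(1) unfolding sun_def pend by (elim conjE) (intro conjI; assumption)
qed

lemma sun_cong: "E \<inter> V \<times> V = E' \<inter> V \<times> V \<Longrightarrow> sun E V = sun E' V"
  using sun_mono by metis

lemma suns_cong:
  fixes E :: "('a \<times> 'a) set"
  assumes "E \<inter> W \<times> W = E' \<inter> W \<times> W"
  shows "suns E W = suns E' W"
proof -
  have "sun E C = sun E' C" if "C \<in> comps E W" for C
    by (rule sun_cong[OF Restr_subset_cong[OF assms compsD(1)[OF that]]])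
  then show ?thesis unfolding suns_def using comps_cong[OF assms] by blast
qed

text \<open>The form in which suns enter constructions: the path from \<open>w\<close> may be
  shorter than three and is then continued outside \<open>C\<close>.\<close>

lemma sun_path_from:
  assumes "sun E C" "w \<in> C"
  obtains p where "dpath E p" "hd p = w" "set p \<subseteq> C" "fac E (C - set p)"
    "C = {w} \<or> 2 \<le> length p"
proof (cases "C = {w}")
  case True
  then show thesis using that[of "[w]"] by (simp add: fac.fac_empty)
next
  case False
  then obtain u where "u \<in> C" "u \<noteq> w" "(w, u) \<in> E" "fac E (C - {w, u})"
    using sunD(3)[OF assms] by blast
  then show thesis using that[of "[w, u]"] assms(2) by (simp add: dpath_def)
qed

subsection \<open>Hall's theorem\<close>

text \<open>A nonempty proper subset with equality splits the problem in two. If there is none,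
  every nonempty proper subset has a neighbour to spare, and one pair may be fixed freely.\<close>

lemma hall:
  assumes "finite A" "\<And>a. a \<in> A \<Longrightarrow> finite (N a)"
    and "\<And>Y. Y \<subseteq> A \<Longrightarrow> card Y \<le> card (\<Union>a\<in>Y. N a)"
  shows "\<exists>f. inj_on f A \<and> (\<forall>a\<in>A. f a \<in> N a)"
  using assms
proof (induction A arbitrary: N rule: finite_psubset_induct)
  case (psubset A)
  have fin: "finite (\<Union>a\<in>Y. N a)" if "Y \<subseteq> A" for Y
    using finite_subset[OF that psubset.hyps] psubset.prems(1) that by auto
  show ?case
  proof (cases "\<exists>Y. Y \<subset> A \<and> Y \<noteq> {} \<and> card Y = card (\<Union>a\<in>Y. N a)")
    case True
    then obtain Y where Y: "Y \<subset> A" "Y \<noteq> {}" "card Y = card (\<Union>a\<in>Y. N a)" by blast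
    define M where "M = (\<Union>a\<in>Y. N a)"
    obtain f where f: "inj_on f Y" "\<forall>a\<in>Y. f a \<in> N a"
    proof -
      have "\<exists>f. inj_on f Y \<and> (\<forall>a\<in>Y. f a \<in> N a)"
        using Y(1) psubset.prems by (intro psubset.IH) auto
      then show thesis using that by blast
    qed
    \<comment> \<open>Hall's condition survives the removal of \<open>M\<close>: apply the old one
      to \<open>Z \<union> Y\<close> and subtract the equality for \<open>Y\<close>.\<close>
    have "\<exists>g. inj_on g (A - Y) \<and> (\<forall>a\<in>A - Y. g a \<in> N a - M)"
    proof (rule psubset.IH)
      show "A - Y \<subset> A" using Y by blast
      show "finite (N a - M)" if "a \<in> A - Y" for a using that psubset.prems(1) by blast
      fix Z assume Z: "Z \<subseteq> A - Y"
      have fZ: "finite Z" "finite Y" 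
        using finite_subset[of Z A] finite_subset[of Y A] Z Y(1) psubset.hyps by auto
      have ZY: "Z \<union> Y \<subseteq> A" using Z Y by blast
      have "card Z + card Y = card (Z \<union> Y)" using Z fZ by (subst card_Un_disjoint) auto
      also have "\<dots> \<le> card (\<Union>a\<in>Z \<union> Y. N a)" using psubset.prems(2)[OF ZY] .
      also have "(\<Union>a\<in>Z \<union> Y. N a) = (\<Union>a\<in>Z. N a - M) \<union> M" unfolding M_def by blast
      also have "card \<dots> \<le> card (\<Union>a\<in>Z. N a - M) + card M" by (rule card_Un_le)
      finally show "card Z \<le> card (\<Union>a\<in>Z. N a - M)" using Y(3) M_def by simp
    qed
    then obtain g where g: "inj_on g (A - Y)" "\<forall>a\<in>A - Y. g a \<in> N a - M" by blast
    define h where "h a = (if a \<in> Y then f a else g a)" for a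
    have fM: "f a \<in> M" if "a \<in> Y" for a using that f(2) M_def by blast
    have "inj_on h A"
    proof (rule inj_onI)
      fix x y assume xy: "x \<in> A" "y \<in> A" "h x = h y"
      show "x = y"
        using xy fM[of x] fM[of y] bspec[OF g(2), of x] bspec[OF g(2), of y] inj_onD[OF f(1), of x y] inj_onD[OF g(1), of x y]
        unfolding h_def by (cases "x \<in> Y"; cases "y \<in> Y") auto
    qed
    moreover have "\<forall>a\<in>A. h a \<in> N a" using f g unfolding h_def by auto
    ultimately show ?thesis by blast
  next
    case False
    show ?thesis
    proof (cases "A = {}")
      case nonempty: False
      then obtain a where a: "a \<in> A" by blast
      have "card {a} \<le> card (N a)" using psubset.prems(2)[of "{a}"] a by simp
      then have "N a \<noteq> {}" by auto
      then obtain b where b: "b \<in> N a" by blast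
      have "\<exists>g. inj_on g (A - {a}) \<and> (\<forall>x\<in>A - {a}. g x \<in> N x - {b})"
      proof (rule psubset.IH)
        show "A - {a} \<subset> A" using a by blast
        show "finite (N x - {b})" if "x \<in> A - {a}" for x using that psubset.prems(1) by blast
        fix Y assume Y: "Y \<subseteq> A - {a}"
        show "card Y \<le> card (\<Union>x\<in>Y. N x - {b})"
        proof (cases "Y = {}")
          case nY: False
          have "Y \<subset> A" using Y a by blast
          then have "card Y \<noteq> card (\<Union>x\<in>Y. N x)" "card Y \<le> card (\<Union>x\<in>Y. N x)"
            using False nY psubset.prems(2)[of Y] by blast+
          moreover have "card (\<Union>x\<in>Y. N x) - 1 \<le> card ((\<Union>x\<in>Y. N x) - {b})"
            using fin[of Y] \<open>Y \<subset> A\<close> by (cases "b \<in> (\<Union>x\<in>Y. N x)") auto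
          moreover have "card ((\<Union>x\<in>Y. N x) - {b}) = card (\<Union>x\<in>Y. N x - {b})"
            by (rule arg_cong[of _ _ card]) blast
          ultimately show ?thesis by linarith
        qed simp
      qed
      then obtain g where g: "inj_on g (A - {a})" "\<forall>x\<in>A - {a}. g x \<in> N x - {b}" by blast
      define h where "h x = (if x = a then b else g x)" for x
      have "inj_on h A"
      proof (rule inj_onI)
        fix x y assume xy: "x \<in> A" "y \<in> A" "h x = h y"
        show "x = y"
          using xy g(2) inj_onD[OF g(1), of x y] unfolding h_def by (cases "x = a"; cases "y = a") auto
      qed
      moreover have "\<forall>x\<in>A. h x \<in> N x" using g b unfolding h_def by auto
      ultimately show ?thesis by blast
    qed simp
  qed
qed

text \<open>Hall's theorem with \<open>c x\<close> copies of each \<open>x\<close>. As the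
  capacities sum to exactly \<open>card A\<close>, every one of them is used up.\<close>

lemma hall_capacities:
  assumes "finite A" "finite X" "\<And>a. a \<in> A \<Longrightarrow> N a \<subseteq> X"
    and hc: "\<And>Y. Y \<subseteq> A \<Longrightarrow> Y \<noteq> {} \<Longrightarrow> card Y \<le> sum c (\<Union>a\<in>Y. N a)"
    and total: "sum c X = card A"
  obtains f where "\<And>a. a \<in> A \<Longrightarrow> f a \<in> N a" "\<And>x. x \<in> X \<Longrightarrow> card {a \<in> A. f a = x} = c x"
proof -
  define M where "M a = (SIGMA x:N a. {..<c x})" for a
  have finN: "finite (N a)" if "a \<in> A" for a using assms(2,3) that finite_subset by blast
  have "\<exists>g. inj_on g A \<and> (\<forall>a\<in>A. g a \<in> M a)"
  proof (rule hall[OF assms(1)])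
    show "finite (M a)" if "a \<in> A" for a unfolding M_def using finN[OF that] by auto
    fix Y assume Y: "Y \<subseteq> A"
    have "finite (\<Union>a\<in>Y. N a)" using finite_subset[OF Y assms(1)] Y finN by auto
    moreover have "(\<Union>a\<in>Y. M a) = (SIGMA x:(\<Union>a\<in>Y. N a). {..<c x})" unfolding M_def by auto
    ultimately have "card (\<Union>a\<in>Y. M a) = sum c (\<Union>a\<in>Y. N a)" by simp
    then show "card Y \<le> card (\<Union>a\<in>Y. M a)" using hc[OF Y] by (cases "Y = {}") simp_all
  qed
  then obtain g where g: "inj_on g A" "\<forall>a\<in>A. g a \<in> M a" by blast
  define f where "f = fst \<circ> g"
  have f: "f a \<in> N a" if "a \<in> A" for a using g(2) that unfolding f_def M_def by auto
  have le: "card {a \<in> A. f a = x} \<le> c x" for x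
  proof -
    have "inj_on (snd \<circ> g) {a \<in> A. f a = x}"
      using g(1) unfolding inj_on_def f_def by (auto simp: prod_eq_iff)
    moreover have "(snd \<circ> g) ` {a \<in> A. f a = x} \<subseteq> {..<c x}"
    proof
      fix i assume "i \<in> (snd \<circ> g) ` {a \<in> A. f a = x}"
      then obtain a where a: "a \<in> A" "f a = x" "i = snd (g a)" by auto
      then show "i \<in> {..<c x}" using bspec[OF g(2) a(1)] unfolding M_def f_def by auto
    qed
    ultimately have "card {a \<in> A. f a = x} \<le> card {..<c x}"
      by (rule card_inj_on_le) simp
    then show ?thesis by simp
  qed
  have "f ` A \<subseteq> X" using f assms(3) by blast
  then have "card A = (\<Sum>x\<in>X. card {a \<in> A. f a = x})"
    using sum.group[OF assms(1,2), of f "\<lambda>_. 1::nat"] by simp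
  then have "(\<Sum>x\<in>X. card {a \<in> A. f a = x}) = sum c X" using total by simp
  then have "card {a \<in> A. f a = x} = c x" if "x \<in> X" for x
    using sum_mono_inv[of "\<lambda>x. card {a \<in> A. f a = x}" X c x] le assms(2) that by blast
  then show thesis using that f by blast
qed

subsection \<open>Joining suns by paths\<close>

text \<open>The path in \<open>C1\<close> reversed, then \<open>m\<close>, then the path in
  \<open>C2\<close>: each contributes at least one vertex, so three are reached even with two
  singleton suns.\<close>

lemma fac_join:
  assumes "sym E" "sun E C1" "sun E C2" "w1 \<in> C1" "w2 \<in> C2" "dpath E m"
    and "(w1, hd m) \<in> E" "(last m, w2) \<in> E"
    and "C1 \<inter> C2 = {}" "C1 \<inter> set m = {}" "C2 \<inter> set m = {}"
  shows "fac E (C1 \<union> set m \<union> C2)"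
proof -
  obtain p1 where p1: "dpath E p1" "hd p1 = w1" "set p1 \<subseteq> C1" "fac E (C1 - set p1)"
    "C1 = {w1} \<or> 2 \<le> length p1"
    using sun_path_from[OF assms(2,4)] .
  obtain p2 where p2: "dpath E p2" "hd p2 = w2" "set p2 \<subseteq> C2" "fac E (C2 - set p2)"
    "C2 = {w2} \<or> 2 \<le> length p2"
    using sun_path_from[OF assms(3,5)] .
  have ne: "p1 \<noteq> []" "p2 \<noteq> []" "m \<noteq> []" using p1(1) p2(1) assms(6) unfolding dpath_def by auto
  have d1: "dpath E (m @ p2)"
  proof (rule dpath_append[OF assms(6) p2(1)])
    show "set m \<inter> set p2 = {}" using p2(3) assms(11) by blast
    show "(last m, hd p2) \<in> E" using p2(2) assms(8) by simp
  qed
  have d: "dpath E (rev p1 @ m @ p2)"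
  proof (rule dpath_append[OF dpath_rev[OF assms(1) p1(1)] d1])
    show "set (rev p1) \<inter> set (m @ p2) = {}"
      using p1(3) p2(3) assms(9,10) unfolding set_append set_rev by blast
    show "(last (rev p1), hd (m @ p2)) \<in> E" using ne p1(2) assms(7) by (simp add: last_rev)
  qed
  have "fac E ((C1 - set p1) \<union> (C2 - set p2))" using p1(4) p2(4)
  proof (rule fac_Un)
    show "(C1 - set p1) \<inter> (C2 - set p2) = {}" using assms(9) by blast
  qed
  then have "fac E (set (rev p1 @ m @ p2) \<union> ((C1 - set p1) \<union> (C2 - set p2)))"
  proof (rule fac.fac_path[OF _ d])
    have "1 \<le> length p1" "1 \<le> length p2" "1 \<le> length m" using ne by (simp_all add: Suc_leI)
    then show "3 \<le> length (rev p1 @ m @ p2)" by simp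
    show "set (rev p1 @ m @ p2) \<inter> ((C1 - set p1) \<union> (C2 - set p2)) = {}"
      using p1(3) p2(3) assms(9-11) unfolding set_append set_rev by blast
  qed
  moreover have "set (rev p1 @ m @ p2) \<union> ((C1 - set p1) \<union> (C2 - set p2)) = C1 \<union> set m \<union> C2"
    using p1(3) p2(3) unfolding set_append set_rev by blast
  ultimately show ?thesis by simp
qed

text \<open>A sun with a second vertex offers a path of order at least two from \<open>w\<close>,
  and \<open>v\<close> in front of it makes three.\<close>

lemma fac_attach:
  assumes "sun E C" "w \<in> C" "C \<noteq> {w}" "(v, w) \<in> E" "v \<notin> C"
  shows "fac E (insert v C)"
proof -
  obtain p where p: "dpath E p" "hd p = w" "set p \<subseteq> C" "fac E (C - set p)"
    and len: "C = {w} \<or> 2 \<le> length p"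
    using sun_path_from[OF assms(1,2)] .
  have d: "dpath E ([v] @ p)"
  proof (rule dpath_append[OF _ p(1)])
    show "set [v] \<inter> set p = {}" using p(3) assms(5) by auto
  qed (use p(2) assms(4) in auto)
  have "fac E (set ([v] @ p) \<union> (C - set p))"
  proof (rule fac.fac_path[OF p(4) d])
    show "3 \<le> length ([v] @ p)" using len assms(3) by simp
    show "set ([v] @ p) \<inter> (C - set p) = {}" using assms(5) by auto
  qed
  moreover have "set ([v] @ p) \<union> (C - set p) = insert v C" using p(3) by auto
  ultimately show ?thesis by simp
qed

text \<open>Each \<open>x\<close> in \<open>X'\<close> is the middle vertex that joins its two suns.
  \<open>X'\<close> may be a proper subset of \<open>X\<close>, so that vertices receiving a single
  sun can be treated separately.\<close>

lemma fac_groups: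
  assumes "sym E" "finite X" "K \<subseteq> suns E (W - X)" "X' \<subseteq> X"
    and f: "\<And>C. C \<in> K \<Longrightarrow> \<exists>w\<in>C. (f C, w) \<in> E"
    and two: "\<And>x. x \<in> X' \<Longrightarrow> card {C \<in> K. f C = x} = 2"
  shows "fac E (X' \<union> \<Union>{C \<in> K. f C \<in> X'})"
proof -
  define T where "T x = insert x (\<Union>{C \<in> K. f C = x})" for x
  have K: "sun E C" "C \<subseteq> W - X" "C \<in> comps E (W - X)" if "C \<in> K" for C
    using assms(3) that compsD(1)[of C E "W - X"] unfolding suns_def by auto
  have "fac E (\<Union>x\<in>X'. T x)"
  proof (rule fac_UN)
    show "finite X'" using assms(2,4) finite_subset by blast
    show "fac E (T x)" if x: "x \<in> X'" for x
    proof -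
      obtain C1 C2 where C: "{C \<in> K. f C = x} = {C1, C2}" "C1 \<noteq> C2"
        using two[OF x] by (auto simp: card_2_iff)
      then have CK: "C1 \<in> K" "C2 \<in> K" "f C1 = x" "f C2 = x" by auto
      obtain w1 w2 where w: "w1 \<in> C1" "w2 \<in> C2" "(x, w1) \<in> E" "(x, w2) \<in> E"
        using f CK by metis
      have "C1 \<inter> C2 = {}" using comps_disjoint K(3) CK(1,2) C(2) by blast
      moreover have "x \<notin> C1" "x \<notin> C2" using K(2) CK x assms(4) by blast+
      ultimately have "fac E (C1 \<union> set [x] \<union> C2)"
        using w(3,4) symD[OF assms(1) w(3)]
        by (intro fac_join[OF assms(1) K(1)[OF CK(1)] K(1)[OF CK(2)] w(1,2)]) auto
      moreover have "C1 \<union> set [x] \<union> C2 = T x" unfolding T_def C(1) by auto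
      ultimately show ?thesis by simp
    qed
    show "T x \<inter> T y = {}" if "x \<in> X'" "y \<in> X'" "x \<noteq> y" for x y
    proof -
      have "C \<inter> D = {}" if "C \<in> K" "D \<in> K" "f C = x" "f D = y" for C D
        using comps_disjoint[OF K(3)[OF that(1)] K(3)[OF that(2)]] that \<open>x \<noteq> y\<close> by blast
      moreover have "x \<notin> C" "y \<notin> C" if "C \<in> K" for C
        using K(2)[OF that] \<open>x \<in> X'\<close> \<open>y \<in> X'\<close> assms(4) by blast+
      ultimately show ?thesis unfolding T_def using \<open>x \<noteq> y\<close> by blast
    qed
  qed
  moreover have "(\<Union>x\<in>X'. T x) = X' \<union> \<Union>{C \<in> K. f C \<in> X'}" unfolding T_def by blast
  ultimately show ?thesis by simp
qed

text \<open>Three distinct leaves are found, at \<open>z\<close> and at two neighbours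
  \<open>y\<close> and \<open>t\<close> of \<open>z\<close>; one of them differs from both
  \<open>u\<close> and \<open>v\<close>.\<close>

lemma sun_pendant_avoiding:
  assumes "sym E" "irrefl E" "sun E V" "3 \<le> card V"
  obtains q z where "pendant E V q z" "q \<noteq> u" "q \<noteq> v"
proof -
  note S = sunD[OF assms(3)]
  have irr: "(x, x) \<notin> E" for x using assms(2) unfolding irrefl_def by blast
  note pD = pendantD[OF _ assms(1,2)]
  obtain q1 z where q1: "pendant E V q1 z" using S(1,4) assms(4) by blast
  note q1' = pD[OF q1]
  \<comment> \<open>A neighbour of \<open>z\<close> other than \<open>q1\<close> cannot be a leaf,
    as it would be a second leaf at \<open>z\<close>; hence it has a leaf of its own.\<close>
  have support: "\<exists>q. pendant E V q y" if y: "y \<in> V" "(z, y) \<in> E" "y \<noteq> q1" for y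
  proof (rule ccontr)
    assume "\<not> ?thesis"
    then obtain x where x: "pendant E V y x" using S(4)[OF assms(4) y(1)] by blast
    then have "x = z" using pD(6)[OF x q1'(2)] symD[OF assms(1) y(2)] by blast
    then show False using S(5)[OF assms(4) x] q1 y(3) by blast
  qed
  have "\<exists>y\<in>V. y \<noteq> q1 \<and> (z, y) \<in> E"
  proof (rule ccontr)
    assume no: "\<not> ?thesis"
    have "{q1, z} = V"
    proof (rule ccontr)
      assume "{q1, z} \<noteq> V"
      then obtain x y where "x \<in> {q1, z}" "y \<in> V - {q1, z}" "(x, y) \<in> E"
        using conn_crossing[OF S(2), of "{q1, z}"] q1'(1,2) by blast
      then show False using no q1'(6) by blast
    qed
    then show False using assms(4) card_2_iff[of V] q1'(5) by fastforce
  qed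
  then obtain y where y: "y \<in> V" "y \<noteq> q1" "(z, y) \<in> E" by blast
  obtain q2 where q2: "pendant E V q2 y" using support y by blast
  note q2' = pD[OF q2]
  have ne: "z \<noteq> y" using y irr by blast
  have q12: "q1 \<noteq> q2" using q1'(3,2) q2'(6) ne by blast
  have "V \<noteq> {y}" using q2' by blast
  then obtain x where x: "x \<in> V" "x \<noteq> y" "(y, x) \<in> E" "fac E (V - {y, x})" using S(3) y by blast
  \<comment> \<open>The partner of \<open>y\<close> must be its leaf: otherwise \<open>q2\<close>
    would be isolated in \<open>V - {y, x}\<close>, which has a factor.\<close>
  have "x = q2"
  proof (rule ccontr)
    assume "x \<noteq> q2"
    then have "q2 \<in> V - {y, x}" "nbrs E (V - {y, x}) q2 \<subseteq> {y}" using q2' unfolding nbrs_def by blast+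
    then show False using fac_pendant[OF x(4) assms(1)] by blast
  qed
  then have "q1 \<in> V - {y, x}" "nbrs E (V - {y, x}) q1 \<subseteq> {z}"
    using q1' y q12 unfolding nbrs_def by blast+
  \<comment> \<open>The leaf \<open>q1\<close> survives the removal of \<open>y\<close> and
    \<open>q2\<close>. The third vertex of its path is a further neighbour of \<open>z\<close>, and
    so it supports a third leaf.\<close>
  then obtain t where t: "t \<in> V - {y, x}" "t \<noteq> q1" "t \<noteq> z" "(z, t) \<in> E"
    using fac_pendant[OF x(4) assms(1)] by metis
  obtain q3 where q3: "pendant E V q3 t" using support t by blast
  note q3' = pD[OF q3]
  have "q1 \<noteq> q3" using q1'(2,3) q3'(6) t(3) by blast
  moreover have "q2 \<noteq> q3" using q2'(2,3) q3'(6) t(1) by blast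
  ultimately show thesis using that q1 q2 q3 q12 by metis
qed

subsection \<open>Deleting an edge\<close>

text \<open>Only the component \<open>R\<close> of the edge changes. A new component inside
  \<open>R\<close> that avoids both ends would have lost no edge, against the connectedness of
  \<open>R\<close>.\<close>

lemma comps_delete_edge:
  assumes "sym E" "(u, v) \<in> E" "u \<in> W" "v \<in> W" "finite W" "E' = E - {(u, v), (v, u)}"
  obtains R where "R \<in> comps E W" "u \<in> R" "v \<in> R"
    "comps E' W = (comps E W - {R}) \<union> comps E' R"
    "\<And>C. C \<in> comps E' R \<Longrightarrow> u \<in> C \<or> v \<in> C" "sym E'"
proof -
  obtain R where R: "R \<in> comps E W" "u \<in> R" using comps_cover[OF assms(5,1,3)] by blast
  note R' = compsD[OF R(1)]
  have v: "v \<in> R" using R'(4)[OF R(2) assms(4,2)] .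
  have WR: "W - R \<union> R = W" using R'(1) by blast
  have "comps E' (W - R \<union> R) = (comps E W - {R}) \<union> comps E' R"
    using R v by (intro comps_replace[OF assms(1) R(1)]) (auto simp: assms(6))
  moreover have "u \<in> C \<or> v \<in> C" if C: "C \<in> comps E' R" for C
  proof (rule ccontr)
    assume no: "\<not> (u \<in> C \<or> v \<in> C)"
    note C' = compsD[OF C]
    have "C \<noteq> R" using no v by blast
    then obtain x y where xy: "x \<in> C" "y \<in> R - C" "(x, y) \<in> E"
      using conn_crossing[OF R'(3) C'(1,2)] by blast
    then have "(x, y) \<in> E'" using no assms(6) by blast
    then show False using C'(4) xy by blast
  qed
  moreover have "sym E'" using assms(1,6) unfolding sym_def by blast
  ultimately show thesis using that R v WR by metis
qed

lemma card_comps_delete_edge: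
  assumes "sym E" "finite W" "E' = E - {(u, v), (v, u)}"
  shows "card (comps E' W) \<le> card (comps E W) + 1"
proof (cases "(u, v) \<in> E \<and> u \<in> W \<and> v \<in> W")
  case False
  then have "E \<inter> W \<times> W = E' \<inter> W \<times> W" using assms(3) symD[OF assms(1)] by auto
  then show ?thesis using comps_cong[of E W E'] by simp
next
  case True
  obtain R where R: "R \<in> comps E W" "comps E' W = (comps E W - {R}) \<union> comps E' R"
    "\<And>C. C \<in> comps E' R \<Longrightarrow> u \<in> C \<or> v \<in> C" "u \<in> R" "v \<in> R" "sym E'"
    using comps_delete_edge[OF assms(1) _ _ _ assms(2,3)] True by metis
  have fR: "finite R" using compsD(1)[OF R(1)] assms(2) finite_subset by blast
  obtain A where A: "A \<in> comps E' R" "u \<in> A" using comps_cover[OF fR R(6,4)] .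
  obtain B where B: "B \<in> comps E' R" "v \<in> B" using comps_cover[OF fR R(6,5)] .
  have "C = A \<or> C = B" if "C \<in> comps E' R" for C
    using R(3)[OF that] comps_disjoint[OF that A(1)] comps_disjoint[OF that B(1)] A(2) B(2) by blast
  then have "comps E' R \<subseteq> {A, B}" by blast
  then have "card (comps E' R) \<le> card {A, B}" by (intro card_mono) auto
  also have "\<dots> \<le> 2" by (simp add: card_insert_if)
  finally have "card (comps E' R) \<le> 2" .
  moreover have "card (comps E W - {R}) + 1 = card (comps E W)"
    using R(1) finite_comps[OF assms(2), of E] card_Suc_Diff1[of "comps E W" R] by simp
  ultimately show ?thesis
    unfolding R(2) using card_Un_le[of "comps E W - {R}" "comps E' R"] by linarith
qed

text \<open>A gain of two is the extreme case: the component of the edge was no sun and falls into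
  two suns. The edge lies inside neither part, so both are suns for \<open>E\<close> as well as for
  \<open>E'\<close>.\<close>

lemma card_suns_delete_edge:
  assumes "sym E" "finite W" "E' = E - {(u, v), (v, u)}"
    and many: "card (suns E W) + 2 \<le> card (suns E' W)"
  obtains R R1 R2 where "R \<in> comps E W" "\<not> sun E R" "sun E R1" "sun E R2" "R1 \<inter> R2 = {}"
    "R1 \<union> R2 = R" "u \<in> R1" "v \<in> R2" "R1 \<in> suns E' R" "R2 \<in> suns E' R"
    "card (suns E' W) = card (suns E W) + 2"
proof (cases "(u, v) \<in> E \<and> u \<in> W \<and> v \<in> W")
  case False
  then have "E \<inter> W \<times> W = E' \<inter> W \<times> W" using assms(3) symD[OF assms(1)] by auto
  then show ?thesis using suns_cong[of E W E'] many by simp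
next
  case True
  obtain R where R: "R \<in> comps E W" "comps E' W = (comps E W - {R}) \<union> comps E' R"
    "\<And>C. C \<in> comps E' R \<Longrightarrow> u \<in> C \<or> v \<in> C" "u \<in> R" "v \<in> R" "sym E'"
    using comps_delete_edge[OF assms(1) _ _ _ assms(2,3)] True by metis
  have fR: "finite R" using compsD(1)[OF R(1)] assms(2) finite_subset by blast
  obtain A where A: "A \<in> comps E' R" "u \<in> A" using comps_cover[OF fR R(6,4)] .
  obtain B where B: "B \<in> comps E' R" "v \<in> B" using comps_cover[OF fR R(6,5)] .
  have AB: "C = A \<or> C = B" if "C \<in> comps E' R" for C
    using R(3)[OF that] comps_disjoint[OF that A(1)] comps_disjoint[OF that B(1)] A(2) B(2) by blast
  have same: "sun E C \<longleftrightarrow> sun E' C" if "\<not> (u \<in> C \<and> v \<in> C)" for C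
    using that assms(3) by (intro sun_cong) auto
  have "sun E C \<longleftrightarrow> sun E' C" if "C \<in> comps E W - {R}" for C
    using that comps_disjoint[of C E W R] R(1,4) by (intro same) blast
  then have sE': "suns E' W = (suns E W - {R}) \<union> suns E' R"
    using R(2) unfolding suns_def by blast
  have fin: "finite (suns E W)" using finite_comps[OF assms(2)] unfolding suns_def by auto
  have le: "card (suns E' W) \<le> card (suns E W - {R}) + card (suns E' R)"
    unfolding sE' by (rule card_Un_le)
  have le1: "card (suns E W - {R}) \<le> card (suns E W)" using fin by (intro card_mono) auto
  have sub: "suns E' R \<subseteq> {A, B}" using AB unfolding suns_def by blast
  have two: "card (suns E' R) \<ge> 2" using le le1 many by linarith
  then have ne: "A \<noteq> B" using card_mono[OF _ sub] by force
  have "suns E' R = {A, B}"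
    using card_seteq[OF _ sub] two ne by simp
  then have sAB: "sun E' A" "sun E' B" "card (suns E' R) = 2" using ne unfolding suns_def by auto
  have "A \<inter> B = {}" using comps_disjoint[OF A(1) B(1)] ne by blast
  moreover have "\<Union>(comps E' R) = R" by (rule Union_comps[OF fR R(6)])
  then have "A \<union> B = R" using AB A B by blast
  moreover have "R \<notin> suns E W"
  proof
    assume "R \<in> suns E W"
    then have "card (suns E W - {R}) + 1 = card (suns E W)"
      using fin card_Suc_Diff1[of "suns E W" R] by simp
    then show False using le many sAB(3) by linarith
  qed
  moreover have "sun E A" "sun E B" using sAB same A B calculation(1) by blast+
  ultimately show thesis
    using that[of R A B] R(1) A B le le1 many sAB unfolding suns_def by simp
qed

subsection \<open>A minimal connected graph without a factor\<close>

lemma Union_comps_disjoint: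
  assumes "K \<subseteq> comps E W" "L \<subseteq> comps E W" "K \<inter> L = {}"
  shows "\<Union>K \<inter> \<Union>L = {}"
proof (rule ccontr)
  assume "\<Union>K \<inter> \<Union>L \<noteq> {}"
  then obtain C D where CD: "C \<in> K" "D \<in> L" "C \<inter> D \<noteq> {}" by blast
  then have "C = D" using comps_disjoint[of C E W D] assms(1,2) by blast
  then show False using CD assms(3) by blast
qed

lemma Union_comps_diff:
  assumes "finite W" "sym E" "C \<in> comps E W"
  shows "\<Union>(comps E W - {C}) = W - C"
proof -
  have "\<Union>(comps E W - {C}) \<inter> \<Union>{C} = {}"
    using assms(3) by (intro Union_comps_disjoint[of _ E W]) auto
  then show ?thesis using Union_comps[OF assms(1,2)] by auto
qed

lemma suns_subset_comps: "suns E W \<subseteq> comps E W"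
  unfolding suns_def by blast

lemma finite_suns: "finite W \<Longrightarrow> finite (suns E W)"
  using finite_comps suns_subset_comps finite_subset by metis

lemma card_suns_split:
  assumes "sym E" "finite W" "R \<in> comps E W" "S \<subseteq> R"
  shows "card (suns E (W - S)) = card (suns E W - {R}) + card (suns E (R - S))"
proof -
  have eq: "suns E (W - S) = (suns E W - {R}) \<union> suns E (R - S)"
    unfolding suns_def comps_delete_verts[OF assms(1,3,4)] by blast
  have "(suns E W - {R}) \<inter> suns E (R - S) = {}"
  proof (rule ccontr)
    assume "\<not> ?thesis"
    then obtain C where C: "C \<in> comps E W" "C \<noteq> R" "C \<in> comps E (R - S)"
      unfolding suns_def by blast
    then show False using comps_disjoint[OF C(1) assms(3)] compsD(1,2)[OF C(3)] by blast
  qed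
  moreover have "finite (suns E W - {R})" "finite (suns E (R - S))"
    using finite_suns[OF assms(2), of E] finite_suns[of "R - S" E] compsD(1)[OF assms(3)] assms(2)
    by (auto intro: finite_subset)
  ultimately show ?thesis unfolding eq by (intro card_Un_disjoint) auto
qed

text \<open>Capacity two, reduced to one on \<open>S\<close>; the additive form avoids truncated
  subtraction.\<close>

lemma sum_capacities:
  "finite N \<Longrightarrow> (\<Sum>x\<in>N. if x \<in> S then 1 else 2) + card (N \<inter> S) = 2 * card N"
proof (induction N rule: finite_induct)
  case (insert x N)
  then show ?case by (cases "x \<in> S") auto
qed simp

text \<open>The induction step of \<open>fac_or_sun\<close>: smaller means losing a vertex of
  \<open>V\<close> or an edge inside \<open>V\<close>. The aim is not a contradiction but
  \<open>sun E V\<close>.\<close>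

locale factorless_graph =
  fixes E :: "('a \<times> 'a) set" and V :: "'a set"
  assumes sym: "sym E" and irr: "irrefl E" and fin: "finite V" and conn: "conn E V"
    and card3: "3 \<le> card V" and nofac: "\<not> fac E V"
    and hyp: "\<And>X. X \<subseteq> V \<Longrightarrow> X \<noteq> {} \<Longrightarrow> card (suns E (V - X)) \<le> 2 * card X"
    and IH: "\<And>E' V'. sym E' \<Longrightarrow> E' \<subseteq> E \<Longrightarrow> V' \<subseteq> V \<Longrightarrow> V' \<noteq> {} \<Longrightarrow> conn E' V' \<Longrightarrow>
      V' \<noteq> V \<or> \<not> E \<inter> V \<times> V \<subseteq> E' \<Longrightarrow>
      (\<And>X. X \<subseteq> V' \<Longrightarrow> X \<noteq> {} \<Longrightarrow> card (suns E' (V' - X)) \<le> 2 * card X) \<Longrightarrow> fac E' V' \<or> sun E' V'"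
begin

lemma no_loop: "(x, x) \<notin> E"
  using irr unfolding irrefl_def by blast

lemma smaller_fac:
  assumes "sym E'" "E' \<subseteq> E" "V' \<subseteq> V" "V' \<noteq> V \<or> \<not> E \<inter> V \<times> V \<subseteq> E'"
    and h: "\<And>X. X \<subseteq> V' \<Longrightarrow> card (suns E' (V' - X)) \<le> 2 * card X"
  shows "fac E' V'"
proof -
  have fV': "finite V'" using assms(3) fin finite_subset by blast
  have "fac E' C" if C: "C \<in> comps E' V'" for C
  proof -
    note C' = compsD[OF C]
    have "fac E' C \<or> sun E' C"
    proof (rule IH[OF assms(1,2)])
      show "C \<subseteq> V" "C \<noteq> {}" "conn E' C" using C' assms(3) by auto
      show "C \<noteq> V \<or> \<not> E \<inter> V \<times> V \<subseteq> E'" using C'(1) assms(3,4) by blast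
      fix S assume S: "S \<subseteq> C" "S \<noteq> {}"
      have "card (suns E' (C - S)) \<le> card (suns E' (V' - S))"
        unfolding card_suns_split[OF assms(1) fV' C S(1)] by simp
      also have "\<dots> \<le> 2 * card S" using h[of S] S(1) C'(1) by blast
      finally show "card (suns E' (C - S)) \<le> 2 * card S" .
    qed
    moreover have "suns E' V' = {}" using h[of "{}"] finite_suns[OF fV', of E'] by simp
    then have "\<not> sun E' C" using C unfolding suns_def by blast
    ultimately show ?thesis by blast
  qed
  then have "fac E' (\<Union>(comps E' V'))" by (intro fac_Union_comps[OF fV']) auto
  then show ?thesis unfolding Union_comps[OF fV' assms(1)] .
qed

text \<open>Deleting \<open>S\<close> inside \<open>R\<close> leaves the suns of the other
  components unchanged, so the slack assumed for the whole graph becomes the bound for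
  \<open>R\<close> alone.\<close>

lemma nonsun_fac:
  assumes X: "X \<subseteq> V" "X \<noteq> {}" and R: "R \<in> comps E (V - X)" "\<not> sun E R"
    and slack: "\<And>S. S \<subseteq> V - X \<Longrightarrow> S \<noteq> {} \<Longrightarrow>
      card (suns E (V - (X \<union> S))) \<le> card (suns E (V - X)) + 2 * card S"
  shows "fac E R"
proof (rule smaller_fac[OF sym])
  note R' = compsD[OF R(1)]
  show "R \<subseteq> V" "R \<noteq> V \<or> \<not> E \<inter> V \<times> V \<subseteq> E" using R'(1) X by blast+
  fix S assume S: "S \<subseteq> R"
  show "card (suns E (R - S)) \<le> 2 * card S"
  proof (cases "S = {}")
    case True
    then have "suns E (R - S) = {}" using comps_conn[OF R'(3,2)] R(2) unfolding suns_def by auto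
    then show ?thesis by simp
  next
    case False
    have "suns E (V - X) - {R} = suns E (V - X)" using R(2) unfolding suns_def by blast
    moreover have "V - (X \<union> S) = V - X - S" by blast
    ultimately have "card (suns E (V - (X \<union> S))) = card (suns E (V - X)) + card (suns E (R - S))"
      using card_suns_split[OF sym _ R(1) S] fin by simp
    then show ?thesis using slack[of S] S R'(1) False by fastforce
  qed
qed simp

section \<open>Distributing suns among deleted vertices by Hall's theorem\<close>

definition touching :: "'a set \<Rightarrow> 'a set \<Rightarrow> 'a set" where
  "touching X C = {x \<in> X. \<exists>w\<in>C. (x, w) \<in> E}"

lemma touching_nonempty:
  assumes "X \<subseteq> V" "X \<noteq> {}" "C \<in> suns E (V - X)"
  shows "touching X C \<noteq> {}"
proof
  assume no: "touching X C = {}"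
  have C: "C \<in> comps E (V - X)" using assms(3) unfolding suns_def by blast
  note C' = compsD[OF C]
  have "C \<subseteq> V" "C \<noteq> V" using C'(1) assms(1,2) by blast+
  then obtain x y where xy: "x \<in> C" "y \<in> V - C" "(x, y) \<in> E"
    using conn_crossing[OF conn _ C'(2)] by metis
  then have "y \<notin> X" using no symD[OF sym] unfolding touching_def by blast
  then show False using C'(4)[of x y] xy by blast
qed

text \<open>The suns in \<open>Y\<close> remain suns when only the vertices touching them are
  deleted. The bound on suns for that smaller set is thus Hall's condition for
  \<open>Y\<close>.\<close>

lemma card_le_touching:
  assumes "X \<subseteq> V" "Y \<subseteq> suns E (V - X)"
  shows "card Y \<le> card (suns E (V - (\<Union>C\<in>Y. touching X C)))"
proof (rule card_mono)
  show "finite (suns E (V - (\<Union>C\<in>Y. touching X C)))" using fin finite_suns by blast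
  show "Y \<subseteq> suns E (V - (\<Union>C\<in>Y. touching X C))"
  proof
    fix C assume CY: "C \<in> Y"
    then have C: "C \<in> comps E (V - X)" "sun E C" using assms(2) unfolding suns_def by blast+
    note C' = compsD[OF C(1)]
    have "C \<in> comps E (V - (\<Union>C\<in>Y. touching X C))"
    proof (rule compsI)
      show "C \<subseteq> V - (\<Union>C\<in>Y. touching X C)" using C'(1) unfolding touching_def by blast
      fix x y assume xy: "x \<in> C" "y \<in> V - (\<Union>C\<in>Y. touching X C)" "(x, y) \<in> E"
      then have "y \<notin> X" using CY symD[OF sym xy(3)] unfolding touching_def by blast
      then show "y \<in> C" using C'(4)[of x y] xy by blast
    qed (fact C')+
    then show "C \<in> suns E (V - (\<Union>C\<in>Y. touching X C))" using C(2) unfolding suns_def by blast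
  qed
qed

lemma touching_Union:
  assumes "X \<subseteq> V" "X \<noteq> {}" "Y \<subseteq> suns E (V - X)" "Y \<noteq> {}"
  shows "(\<Union>C\<in>Y. touching X C) \<subseteq> X" "(\<Union>C\<in>Y. touching X C) \<noteq> {}"
proof -
  show "(\<Union>C\<in>Y. touching X C) \<subseteq> X" unfolding touching_def by blast
  obtain C where C: "C \<in> Y" using assms(4) by blast
  then have "touching X C \<noteq> {}" using touching_nonempty[OF assms(1,2)] assms(3) by blast
  then show "(\<Union>C\<in>Y. touching X C) \<noteq> {}" using C by blast
qed

lemma finite_touching: "X \<subseteq> V \<Longrightarrow> finite (\<Union>C\<in>Y. touching X C)"
  by (rule finite_subset[OF _ fin]) (auto simp: touching_def)

lemma fac_assemble:
  assumes "X \<subseteq> V" "fac E (X \<union> \<Union>(suns E (V - X)))"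
    and "\<And>R. R \<in> comps E (V - X) \<Longrightarrow> \<not> sun E R \<Longrightarrow> fac E R"
  shows "fac E V"
proof -
  let ?N = "comps E (V - X) - suns E (V - X)"
  have fW: "finite (V - X)" using fin by blast
  have U: "\<Union>(comps E (V - X)) = V - X" using Union_comps[OF fW sym] .
  have "fac E (\<Union>?N)" using assms(3) by (intro fac_Union_comps[OF fW]) (auto simp: suns_def)
  moreover have "\<Union>(suns E (V - X)) \<inter> \<Union>?N = {}"
    by (rule Union_comps_disjoint[of _ E "V - X"]) (auto simp: suns_def)
  then have "(X \<union> \<Union>(suns E (V - X))) \<inter> \<Union>?N = {}" using U by blast
  moreover have "X \<union> \<Union>(suns E (V - X)) \<union> \<Union>?N = V"
    using U assms(1) suns_subset_comps[of E "V - X"] by blast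
  ultimately show ?thesis using fac_Un[OF assms(2)] by metis
qed

text \<open>With equality, every vertex of \<open>X\<close> can be given exactly two suns and joins
  them by a path. The remaining components have factors because, by tightness, deleting a further
  \<open>S\<close> creates at most \<open>2 * card S\<close> suns. Together these would cover
  \<open>V\<close>.\<close>

lemma not_tight:
  assumes X: "X \<subseteq> V" "X \<noteq> {}"
  shows "card (suns E (V - X)) < 2 * card X"
proof (rule ccontr)
  assume "\<not> ?thesis"
  then have tight: "card (suns E (V - X)) = 2 * card X" using hyp[OF X] by linarith
  let ?K = "suns E (V - X)"
  have fX: "finite X" using X fin finite_subset by blast
  have fK: "finite ?K" using fin finite_suns by blast
  have total: "(\<Sum>x\<in>X. 2) = card ?K" using tight by simp
  obtain f where f: "\<And>C. C \<in> ?K \<Longrightarrow> f C \<in> touching X C"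
    "\<And>x. x \<in> X \<Longrightarrow> card {C \<in> ?K. f C = x} = 2"
  proof (rule hall_capacities[OF fK fX _ _ total, of "touching X"])
    fix f assume "\<And>C. C \<in> ?K \<Longrightarrow> f C \<in> touching X C" "\<And>x. x \<in> X \<Longrightarrow> card {C \<in> ?K. f C = x} = 2"
    then show thesis by (rule that)
  next
    show "touching X C \<subseteq> X" for C unfolding touching_def by blast
    fix Y assume Y: "Y \<subseteq> ?K" "Y \<noteq> {}"
    let ?N = "\<Union>C\<in>Y. touching X C"
    have "?N \<subseteq> V" "?N \<noteq> {}" using touching_Union[OF X Y] X(1) by auto
    then show "card Y \<le> (\<Sum>x\<in>?N. 2)" using card_le_touching[OF X(1) Y(1)] hyp[of ?N] by simp
  qed
  have fX': "f C \<in> X" "\<exists>w\<in>C. (f C, w) \<in> E" if "C \<in> ?K" for C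
    using f(1)[OF that] unfolding touching_def by blast+
  have "fac E (X \<union> \<Union>{C \<in> ?K. f C \<in> X})"
    using fX' f(2) by (intro fac_groups[OF sym fX]) auto
  moreover have "{C \<in> ?K. f C \<in> X} = ?K" using fX' by blast
  ultimately have "fac E (X \<union> \<Union>?K)" by simp
  then have "fac E V"
  proof (rule fac_assemble[OF X(1)])
    fix R assume R: "R \<in> comps E (V - X)" "\<not> sun E R"
    show "fac E R"
    proof (rule nonsun_fac[OF X R])
      fix S assume S: "S \<subseteq> V - X" "S \<noteq> {}"
      have "card (X \<union> S) = card X + card S"
        using S fX fin finite_subset[of S V] by (intro card_Un_disjoint) auto
      moreover have "X \<union> S \<subseteq> V" "X \<union> S \<noteq> {}" using S X by auto
      ultimately show "card (suns E (V - (X \<union> S))) \<le> card ?K + 2 * card S"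
        using hyp[of "X \<union> S"] tight by linarith
    qed
  qed
  then show False using nofac by blast
qed

section \<open>Sets of deficit one\<close>

definition bad :: "'a set \<Rightarrow> bool" where
  "bad B \<longleftrightarrow> B \<subseteq> V \<and> B \<noteq> {} \<and> 2 * card B \<le> card (suns E (V - B)) + 1"

lemma badD:
  assumes "bad B"
  shows "B \<subseteq> V" "B \<noteq> {}" "card (suns E (V - B)) + 1 = 2 * card B" "finite B"
  using assms not_tight[of B] fin unfolding bad_def by (auto intro: finite_subset)

text \<open>A slack of two is the most that the deletion of an edge can consume, so afterwards only
  bad sets can violate the bound.\<close>

lemma not_bad:
  assumes "X \<subseteq> V" "X \<noteq> {}" "\<not> bad X"
  shows "card (suns E (V - X)) + 2 \<le> 2 * card X"
  using assms unfolding bad_def by auto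

lemma bad_nonsun_fac:
  assumes "bad B" "R \<in> comps E (V - B)" "\<not> sun E R"
  shows "fac E R"
proof (rule nonsun_fac[OF badD(1,2)[OF assms(1)] assms(2,3)])
  fix S assume S: "S \<subseteq> V - B" "S \<noteq> {}"
  have "card (B \<union> S) = card B + card S"
    using S badD(4)[OF assms(1)] fin finite_subset[of S V] by (intro card_Un_disjoint) auto
  moreover have "B \<union> S \<subseteq> V" "B \<union> S \<noteq> {}" using S badD(1)[OF assms(1)] by auto
  ultimately show "card (suns E (V - (B \<union> S))) \<le> card (suns E (V - B)) + 2 * card S"
    using not_tight[of "B \<union> S"] badD(3)[OF assms(1)] by linarith
qed

text \<open>Capacity one at \<open>v\<close> and two elsewhere sums to the number of suns. By
  \<open>not_tight\<close> every set of touched vertices has one unit to spare, which pays for the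
  reduction at \<open>v\<close>.\<close>

lemma bad_assign:
  assumes B: "bad B" and v: "v \<in> B"
  obtains C w where "C \<in> suns E (V - B)" "w \<in> C" "(v, w) \<in> E"
    "fac E (B - {v} \<union> \<Union>(suns E (V - B) - {C}))"
proof -
  note B' = badD[OF B]
  let ?K = "suns E (V - B)"
  have fK: "finite ?K" using fin finite_suns by blast
  let ?c = "\<lambda>x. if x \<in> {v} then 1 else 2"
  have total: "sum ?c B = card ?K" using sum_capacities[OF B'(4), of "{v}"] B'(3) v by simp
  obtain f where f: "\<And>C. C \<in> ?K \<Longrightarrow> f C \<in> touching B C"
    "\<And>x. x \<in> B \<Longrightarrow> card {C \<in> ?K. f C = x} = ?c x"
  proof (rule hall_capacities[OF fK B'(4) _ _ total, of "touching B"])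
    fix f assume "\<And>C. C \<in> ?K \<Longrightarrow> f C \<in> touching B C"
      "\<And>x. x \<in> B \<Longrightarrow> card {C \<in> ?K. f C = x} = ?c x"
    then show thesis by (rule that)
  next
    show "touching B C \<subseteq> B" for C unfolding touching_def by blast
    fix Y assume Y: "Y \<subseteq> ?K" "Y \<noteq> {}"
    let ?N = "\<Union>C\<in>Y. touching B C"
    have N: "?N \<subseteq> V" "?N \<noteq> {}"
      using touching_Union[OF B'(1,2) Y] B'(1) by auto
    have "card (?N \<inter> {v}) \<le> card {v}" by (intro card_mono) auto
    then show "card Y \<le> sum ?c ?N"
      using card_le_touching[OF B'(1) Y(1)] not_tight[OF N]
        sum_capacities[OF finite_touching[OF B'(1), of Y], of "{v}"] by simp
  qed
  have fB: "f C \<in> B" "\<exists>w\<in>C. (f C, w) \<in> E" if "C \<in> ?K" for C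
    using f(1)[OF that] unfolding touching_def by blast+
  have "card {C \<in> ?K. f C = v} = 1" using f(2)[OF v] by simp
  then obtain C where C: "{C \<in> ?K. f C = v} = {C}" by (auto simp: card_1_singleton_iff)
  have C': "D \<in> ?K \<and> f D = v \<longleftrightarrow> D = C" for D using eqset_imp_iff[OF C, of D] by simp
  have "fac E (B - {v} \<union> \<Union>{C \<in> ?K. f C \<in> B - {v}})"
    using fB f(2) by (intro fac_groups[OF sym B'(4)]) auto
  moreover have "{C \<in> ?K. f C \<in> B - {v}} = ?K - {C}" using C' fB(1) by blast
  moreover obtain w where "w \<in> C" "(v, w) \<in> E" using C'[of C] fB(2)[of C] by blast
  ultimately show thesis using that[of C w] C'[of C] by simp
qed

text \<open>If the one sun assigned to \<open>v\<close> had two vertices, \<open>fac_attach\<close>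
  would complete a factor of \<open>V\<close>. So it is a single \<open>w\<close>, and the rest of
  the construction covers \<open>V - {v, w}\<close>, as the definition of \<open>sun\<close> demands
  at \<open>v\<close>.\<close>

lemma bad_flex:
  assumes B: "bad B" and v: "v \<in> B"
  obtains w where "{w} \<in> suns E (V - B)" "(v, w) \<in> E" "fac E (V - {v, w})"
proof -
  note B' = badD[OF B]
  let ?K = "suns E (V - B)" and ?N = "comps E (V - B) - suns E (V - B)"
  obtain C w where C: "C \<in> ?K" "w \<in> C" "(v, w) \<in> E" and fac: "fac E (B - {v} \<union> \<Union>(?K - {C}))"
    using bad_assign[OF B v] .
  have fW: "finite (V - B)" using fin by blast
  have CC: "C \<in> comps E (V - B)" "sun E C" using C(1) unfolding suns_def by auto
  have vC: "v \<notin> C" using compsD(1)[OF CC(1)] v by blast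
  have disj: "D \<inter> C = {}" if "D \<in> ?K - {C}" for D
    using comps_disjoint[of D E "V - B" C] CC(1) that unfolding suns_def by blast
  have CB: "D \<subseteq> V - B" if "D \<in> ?K" for D using that compsD(1)[of D E] unfolding suns_def by blast
  have single: "C = {w}"
  proof (rule ccontr)
    assume "C \<noteq> {w}"
    then have "fac E (insert v C)" using fac_attach CC(2) C(2,3) vC by metis
    moreover have "(B - {v} \<union> \<Union>(?K - {C})) \<inter> insert v C = {}"
      using disj CB v CB[OF C(1)] by blast
    ultimately have "fac E (B - {v} \<union> \<Union>(?K - {C}) \<union> insert v C)" by (rule fac_Un[OF fac])
    moreover have "B - {v} \<union> \<Union>(?K - {C}) \<union> insert v C = B \<union> \<Union>?K" using C(1) v by blast
    ultimately have "fac E V" using fac_assemble[OF B'(1)] bad_nonsun_fac[OF B] by simp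
    then show False using nofac by blast
  qed
  have "fac E (\<Union>?N)"
    using bad_nonsun_fac[OF B] by (intro fac_Union_comps[OF fW]) (auto simp: suns_def)
  moreover have U: "\<Union>(comps E (V - B)) = V - B" using Union_comps[OF fW sym] .
  have "\<Union>?K \<inter> \<Union>?N = {}"
    by (rule Union_comps_disjoint[of _ E "V - B"]) (auto simp: suns_def)
  then have "(B - {v} \<union> \<Union>(?K - {C})) \<inter> \<Union>?N = {}" using U by blast
  ultimately have "fac E (B - {v} \<union> \<Union>(?K - {C}) \<union> \<Union>?N)" by (rule fac_Un[OF fac])
  moreover have "B - {v} \<union> \<Union>(?K - {C}) \<union> \<Union>?N = V - {v, w}"
  proof -
    have "\<Union>(?K - {C}) \<union> \<Union>?N = V - B - {w}"
    proof -
      have "\<Union>(?K - {C}) \<union> \<Union>?N = \<Union>(comps E (V - B) - {C})"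
        using C(1) suns_subset_comps[of E "V - B"] by blast
      also have "\<dots> = V - B - C"
        by (rule Union_comps_diff[OF fW sym CC(1)])
      finally show ?thesis using single by simp
    qed
    moreover have "w \<notin> B" using compsD(1)[OF CC(1)] C(2) by blast
    ultimately show ?thesis using B'(1) v by blast
  qed
  ultimately show thesis using that[of w] C single by simp
qed


text \<open>If the singleton \<open>c\<close> given by \<open>bad_flex\<close> is not a leaf, its
  second neighbour \<open>x\<close> lies in \<open>B\<close>. The stretch \<open>v, c, x\<close>
  then extends by one sun at each end, and the other vertices of \<open>B\<close> absorb the
  remaining suns.\<close>

lemma bad_supports:
  assumes "bad B" "v \<in> B"
  shows "\<exists>q. pendant E V q v"
proof (rule ccontr)
  assume no: "\<not> ?thesis"
  define P where "P B \<longleftrightarrow> bad B \<and> v \<in> B" for B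
  have "P B" using assms P_def by simp
  \<comment> \<open>Minimality is needed for Hall's condition: a set of touched vertices that is bad
    and contains \<open>v\<close> must be all of \<open>B\<close>.\<close>
  then obtain B where "P B" and min: "\<And>B'. P B' \<Longrightarrow> card B \<le> card B'"
    using ex_has_least_nat[of P B card] by blast
  then have B: "bad B" and v: "v \<in> B" using P_def by auto
  note B' = badD[OF B]
  let ?W = "V - B"
  let ?S = "suns E ?W"
  obtain c where c: "{c} \<in> ?S" "(v, c) \<in> E" using bad_flex[OF B v] by metis
  have cC: "{c} \<in> comps E ?W" using c(1) suns_subset_comps by blast
  have cW: "c \<in> V" "c \<notin> B" using compsD(1)[OF cC] by auto
  have "\<exists>x\<in>V. (c, x) \<in> E \<and> x \<noteq> v"
  proof (rule ccontr)
    assume "\<not> ?thesis"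
    then have "pendant E V c v" using B'(1) v cW c(2) symD[OF sym] by (intro pendantI) auto
    then show False using no by blast
  qed
  then obtain x where x: "x \<in> V" "(c, x) \<in> E" "x \<noteq> v" by blast
  have xB: "x \<in> B"
  proof (rule ccontr)
    assume "x \<notin> B"
    then have "x \<in> {c}" using compsD(4)[OF cC, of c x] x by simp
    then show False using x no_loop by simp
  qed
  define K where "K = ?S - {{c}}"
  have fS: "finite ?S" using fin finite_suns by blast
  then have fK: "finite K" unfolding K_def by simp
  have KS: "K \<subseteq> ?S" unfolding K_def by blast
  have cardK: "card K + 2 = 2 * card B"
  proof -
    have "card K + 1 = card ?S" unfolding K_def using c(1) fS card_Suc_Diff1[of ?S "{c}"] by simp
    then show ?thesis using B'(3) by linarith
  qed
  \<comment> \<open>With \<open>c\<close> withheld, \<open>2 * card B - 2\<close> suns remain; this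
    is the total when \<open>v\<close> and \<open>x\<close> take one sun each and the others
    two.\<close>
  let ?c = "\<lambda>y. if y \<in> {v, x} then 1 else 2"
  have card_vx: "card {v, x} = 2" using x(3) by simp
  have total: "sum ?c B = card K"
  proof -
    have "B \<inter> {v, x} = {v, x}" using v xB by blast
    then show ?thesis using sum_capacities[OF B'(4), of "{v, x}"] cardK card_vx by simp
  qed
  obtain f where f: "\<And>C. C \<in> K \<Longrightarrow> f C \<in> touching B C"
    "\<And>y. y \<in> B \<Longrightarrow> card {C \<in> K. f C = y} = ?c y"
  proof (rule hall_capacities[OF fK B'(4) _ _ total, of "touching B"])
    fix f assume "\<And>C. C \<in> K \<Longrightarrow> f C \<in> touching B C" "\<And>y. y \<in> B \<Longrightarrow> card {C \<in> K. f C = y} = ?c y"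
    then show thesis by (rule that)
  next
    show "touching B C \<subseteq> B" for C unfolding touching_def by blast
    fix Y assume Y: "Y \<subseteq> K" "Y \<noteq> {}"
    have YS: "Y \<subseteq> ?S" using Y(1) KS by (rule subset_trans)
    let ?N = "\<Union>C\<in>Y. touching B C"
    have NB: "?N \<subseteq> B" "?N \<noteq> {}" using touching_Union[OF B'(1,2) YS Y(2)] by auto
    then have N: "?N \<subseteq> V" "?N \<noteq> {}" using B'(1) by auto
    have fN: "finite ?N" using finite_touching[OF B'(1)] .
    have cap: "sum ?c ?N + card (?N \<inter> {v, x}) = 2 * card ?N" by (rule sum_capacities[OF fN])
    have le: "card Y \<le> card (suns E (V - ?N))" by (rule card_le_touching[OF B'(1) YS])
    have N2: "card (?N \<inter> {v, x}) \<le> 2"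
      using card_mono[of "{v, x}" "?N \<inter> {v, x}"] card_vx by simp
    show "card Y \<le> sum ?c ?N"
    \<comment> \<open>At most two units are lost, at \<open>v\<close> and \<open>x\<close>. A set
      that is not bad has two to spare; one without \<open>v\<close> loses at most one; a bad one
      containing \<open>v\<close> is \<open>B\<close>, where the total is exact.\<close>
    proof (cases "bad ?N \<and> v \<in> ?N")
      case True
      then have "card B \<le> card ?N" using min P_def by simp
      then have "?N = B" using card_seteq[OF B'(4) NB(1)] by simp
      moreover have "card Y \<le> card K" using card_mono[OF fK Y(1)] .
      ultimately show ?thesis using total by simp
    next
      case False
      then consider "v \<notin> ?N" | "\<not> bad ?N" by blast
      then show ?thesis
      proof cases
        case 1
        then have "?N \<inter> {v, x} \<subseteq> {x}" by blast
        then have "card (?N \<inter> {v, x}) \<le> 1" using card_mono[of "{x}" "?N \<inter> {v, x}"] by simp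
        then show ?thesis using cap le not_tight[OF N] by linarith
      next
        case 2
        then show ?thesis using cap le not_bad[OF N 2] N2 by linarith
      qed
    qed
  qed
  have fB: "f C \<in> B" "\<exists>w\<in>C. (f C, w) \<in> E" if "C \<in> K" for C
    using f(1)[OF that] unfolding touching_def by blast+
  have "card {C \<in> K. f C = v} = 1" using f(2)[OF v] by simp
  then obtain C1 where "{C \<in> K. f C = v} = {C1}" by (auto simp: card_1_singleton_iff)
  then have C1: "D \<in> K \<and> f D = v \<longleftrightarrow> D = C1" for D by (auto dest: eqset_imp_iff[of _ _ D])
  have "card {C \<in> K. f C = x} = 1" using f(2)[OF xB] by simp
  then obtain C2 where "{C \<in> K. f C = x} = {C2}" by (auto simp: card_1_singleton_iff)
  then have C2: "D \<in> K \<and> f D = x \<longleftrightarrow> D = C2" for D by (auto dest: eqset_imp_iff[of _ _ D])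
  have C1K: "C1 \<in> K" "f C1 = v" using C1[of C1] by auto
  have C2K: "C2 \<in> K" "f C2 = x" using C2[of C2] by auto
  obtain w1 where w1: "w1 \<in> C1" "(v, w1) \<in> E" using fB(2)[OF C1K(1)] C1K(2) by auto
  obtain w2 where w2: "w2 \<in> C2" "(x, w2) \<in> E" using fB(2)[OF C2K(1)] C2K(2) by auto
  have KC: "C \<in> comps E ?W" "sun E C" "C \<subseteq> ?W" "c \<notin> C" if "C \<in> K" for C
  proof -
    show C: "C \<in> comps E ?W" "sun E C" using that KS unfolding suns_def by auto
    show "C \<subseteq> ?W" by (rule compsD(1)[OF C(1)])
    show "c \<notin> C" using comps_disjoint[OF C(1) cC] that unfolding K_def by auto
  qed
  have "fac E (C1 \<union> set [v, c, x] \<union> C2)"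
  proof (rule fac_join[OF sym KC(2)[OF C1K(1)] KC(2)[OF C2K(1)] w1(1) w2(1)])
    show "dpath E [v, c, x]" using c(2) x cW(2) v xB unfolding dpath_def by auto
    show "(w1, hd [v, c, x]) \<in> E" using symD[OF sym w1(2)] by simp
    show "(last [v, c, x], w2) \<in> E" using w2(2) by simp
    show "C1 \<inter> C2 = {}"
      using comps_disjoint[OF KC(1)[OF C1K(1)] KC(1)[OF C2K(1)]] C1K(2) C2K(2) x(3) by auto
    show "C1 \<inter> set [v, c, x] = {}" using KC(3,4)[OF C1K(1)] v xB by auto
    show "C2 \<inter> set [v, c, x] = {}" using KC(3,4)[OF C2K(1)] v xB by auto
  qed
  moreover have rest: "{C \<in> K. f C \<in> B - {v, x}} = K - {C1, C2}" using C1 C2 fB(1) by blast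
  have "fac E (B - {v, x} \<union> \<Union>{C \<in> K. f C \<in> B - {v, x}})"
    using fB(2) f(2) KS by (intro fac_groups[OF sym B'(4)]) auto
  then have "fac E (B - {v, x} \<union> \<Union>(K - {C1, C2}))" unfolding rest .
  moreover have "(C1 \<union> set [v, c, x] \<union> C2) \<inter> (B - {v, x} \<union> \<Union>(K - {C1, C2})) = {}"
  proof -
    have "\<Union>{C1, C2, {c}} \<inter> \<Union>(K - {C1, C2}) = {}"
      using KC(1) cC C1K(1) C2K(1) by (intro Union_comps_disjoint[of _ E ?W]) (auto simp: K_def)
    moreover have "\<Union>(K - {C1, C2}) \<inter> B = {}" using KC(3) by blast
    moreover have "C1 \<inter> B = {}" "C2 \<inter> B = {}" using KC(3) C1K(1) C2K(1) by blast+
    ultimately show ?thesis using v xB cW(2) by auto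
  qed
  ultimately have "fac E (C1 \<union> set [v, c, x] \<union> C2 \<union> (B - {v, x} \<union> \<Union>(K - {C1, C2})))"
    by (rule fac_Un)
  moreover have "C1 \<union> set [v, c, x] \<union> C2 \<union> (B - {v, x} \<union> \<Union>(K - {C1, C2})) = B \<union> \<Union>?S"
  proof -
    have "?S = insert {c} (insert C1 (insert C2 (K - {C1, C2})))"
      using c(1) C1K(1) C2K(1) unfolding K_def by blast
    then have "\<Union>?S = {c} \<union> C1 \<union> C2 \<union> \<Union>(K - {C1, C2})" by (simp add: Un_assoc)
    then show ?thesis using v xB by auto
  qed
  ultimately have "fac E (B \<union> \<Union>?S)" by simp
  then have "fac E V" by (rule fac_assemble[OF B'(1)]) (rule bad_nonsun_fac[OF B])
  then show False using nofac by blast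
qed

section \<open>Leaves and edge deletion in a factorless graph\<close>

lemma pendant_sun:
  assumes "pendant E V q z"
  shows "{q} \<in> suns E (V - {z})"
proof -
  note p = pendantD[OF assms sym irr]
  have "{q} \<in> comps E (V - {z})" using p(1,5,6) by (intro compsI) (auto simp: conn_singleton)
  then show ?thesis using sun_singleton[of E q] unfolding suns_def by blast
qed

text \<open>For a one-element set a single sun already gives deficit one.\<close>

lemma sun_comp_bad:
  assumes "C \<in> suns E (V - {z})" "z \<in> V"
  shows "bad {z}"
proof -
  have "finite (suns E (V - {z}))" using fin finite_suns by blast
  then have "1 \<le> card (suns E (V - {z}))" using assms(1) card_gt_0_iff[of "suns E (V - {z})"] by auto
  then show ?thesis unfolding bad_def using assms(2) by simp
qed

lemma pendant_bad: "pendant E V q z \<Longrightarrow> bad {z}"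
  using sun_comp_bad[OF pendant_sun] pendantD(2)[OF _ sym irr] by blast

text \<open>As \<open>{z}\<close> is bad, exactly one sun remains, and the leaf \<open>q\<close> is
  one. This makes the leaf at a support unique.\<close>

lemma pendant_only_sun:
  assumes "pendant E V q z" "D \<in> suns E (V - {z})"
  shows "D = {q}"
proof -
  have "card (suns E (V - {z})) = 1" using badD(3)[OF pendant_bad[OF assms(1)]] by simp
  then obtain K where "suns E (V - {z}) = {K}" by (auto simp: card_1_singleton_iff)
  then show ?thesis using assms(2) pendant_sun[OF assms(1)] by auto
qed

lemma not_pendant_support:
  assumes "pendant E V q z" "pendant E V r q"
  shows False
proof -
  note q = pendantD[OF assms(1) sym irr] and r = pendantD[OF assms(2) sym irr]
  have rz: "r = z" using q(6)[OF r(1) r(4)] .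
  have "{q, z} = V"
  proof (rule ccontr)
    assume "{q, z} \<noteq> V"
    then obtain x y where xy: "x \<in> {q, z}" "y \<in> V - {q, z}" "(x, y) \<in> E"
      using conn_crossing[OF conn, of "{q, z}"] q(1,2) by auto
    then show False using q(6)[of y] r(6)[of y] rz by auto
  qed
  then have "card V = 2" using q(5) by auto
  then show False using card3 by simp
qed

text \<open>Without a sun component the bound would extend to \<open>X = {}\<close>, and
  \<open>smaller_fac\<close> would give a factor for \<open>E'\<close>, hence for
  \<open>E\<close>.\<close>

lemma delete_edge_sun:
  assumes "u \<in> V" "v \<in> V" "(u, v) \<in> E" "E' = E - {(u, v), (v, u)}"
    and h: "\<And>X. X \<subseteq> V \<Longrightarrow> X \<noteq> {} \<Longrightarrow> card (suns E' (V - X)) \<le> 2 * card X"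
  obtains A where "A \<in> comps E' V" "sun E' A"
proof (rule ccontr)
  assume "\<not> thesis"
  then have none: "suns E' V = {}" using that unfolding suns_def by blast
  have "fac E' V"
  proof (rule smaller_fac)
    show "sym E'" using sym assms(4) unfolding sym_def by blast
    show "V \<noteq> V \<or> \<not> E \<inter> V \<times> V \<subseteq> E'" using assms(1-4) by auto
    show "card (suns E' (V - X)) \<le> 2 * card X" if "X \<subseteq> V" for X
      using h[OF that] none by (cases "X = {}") auto
  qed (use assms(4) in auto)
  then have "fac E V" using fac_mono[of E' V E] assms(4) by auto
  then show False using nofac by blast
qed

text \<open>The deleted edge is the only one by which \<open>A\<close> could be left, so
  \<open>A\<close> is a sun component of \<open>V - {v}\<close> for \<open>E\<close> itself.\<close>

lemma sun_side_bad:
  assumes "E' = E - {(u, v), (v, u)}" "A \<in> comps E' V" "sun E' A" "u \<in> A" "v \<in> V" "v \<notin> A"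
  shows "bad {v}"
proof -
  note A = compsD[OF assms(2)]
  have "A \<in> comps E (V - {v})"
  proof (rule compsI)
    show "A \<subseteq> V - {v}" using A(1) assms(6) by blast
    show "A \<noteq> {}" by (rule A(2))
    show "conn E A" using conn_mono[OF A(3), of E] assms(1) by auto
    fix x y assume xy: "x \<in> A" "y \<in> V - {v}" "(x, y) \<in> E"
    then have "(x, y) \<in> E'" using assms(1,6) by auto
    then show "y \<in> A" using A(4)[of x y] xy by blast
  qed
  moreover have "sun E A"
  proof (rule sun_mono[OF assms(3)])
    show "E' \<inter> A \<times> A = E \<inter> A \<times> A" using assms(1,6) by auto
  qed
  ultimately show ?thesis using sun_comp_bad assms(5) unfolding suns_def by blast
qed

text \<open>Without leaves \<open>bad_supports\<close> rules out bad sets, so deleting any edge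
  preserves the bound. The resulting sun spans \<open>V\<close>, and one of its leaves avoids the
  deleted edge and is a leaf for \<open>E\<close> too.\<close>

lemma exists_pendant: "\<exists>q z. pendant E V q z"
proof (rule ccontr)
  assume no: "\<not> ?thesis"
  then have nobad: "\<not> bad X" for X using bad_supports badD(2) by blast
  obtain a where a: "a \<in> V" using card3 by fastforce
  have "{a} \<noteq> V" using card3 by auto
  then obtain x v where "x \<in> {a}" "v \<in> V - {a}" "(x, v) \<in> E"
    using conn_crossing[OF conn, of "{a}"] a by auto
  then have v: "v \<in> V" "(a, v) \<in> E" by auto
  define E' where "E' = E - {(a, v), (v, a)}"
  have sym': "sym E'" using sym unfolding E'_def sym_def by blast
  have irr': "irrefl E'" using irr unfolding E'_def irrefl_def by blast
  obtain A where A: "A \<in> comps E' V" "sun E' A"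
  proof (rule delete_edge_sun[OF a v E'_def])
    fix X assume X: "X \<subseteq> V" "X \<noteq> {}"
    have fW: "finite (V - X)" using fin by blast
    show "card (suns E' (V - X)) \<le> 2 * card X"
    proof (cases "card (suns E (V - X)) + 2 \<le> card (suns E' (V - X))")
      case True
      show ?thesis
        by (rule card_suns_delete_edge[OF sym fW E'_def True]) (use not_bad[OF X nobad] in linarith)
    next
      case False
      then show ?thesis using not_bad[OF X nobad] by linarith
    qed
  qed
  have "A = V"
  proof (rule ccontr)
    assume "A \<noteq> V"
    then obtain x y where xy: "x \<in> A" "y \<in> V - A" "(x, y) \<in> E"
      using conn_crossing[OF conn compsD(1,2)[OF A(1)]] by metis
    then have "(x, y) \<notin> E'" using compsD(4)[OF A(1)] by blast
    then have "x = a \<and> y = v \<or> x = v \<and> y = a" using xy(3) unfolding E'_def by blast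
    then have "E' = E - {(x, y), (y, x)}" unfolding E'_def by auto
    then have "bad {y}" using sun_side_bad[of E' x y A] A xy by blast
    then show False using nobad by blast
  qed
  then have "sun E' V" using A by simp
  then obtain q z where q: "pendant E' V q z" "q \<noteq> a" "q \<noteq> v"
    using sun_pendant_avoiding[OF sym' irr' _ card3] by metis
  then have "nbrs E V q = nbrs E' V q" unfolding nbrs_def E'_def by auto
  then have "pendant E V q z" using q(1) unfolding pendant_def by simp
  then show False using no by blast
qed


text \<open>The second edge at \<open>v\<close> is deleted, keeping the one to a support
  \<open>z\<close>. A sun of the remaining graph in which \<open>v\<close> supports nothing makes
  \<open>v\<close> a leaf at \<open>z\<close>, which already has the leaf \<open>q\<close>. Most of
  the work is to show that the deletion preserves the bound.\<close>

lemma all_pendant: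
  assumes "v \<in> V"
  shows "\<exists>u. pendant E V v u \<or> pendant E V u v"
proof (rule ccontr)
  assume contra: "\<not> ?thesis"
  define N where "N = {v \<in> V. \<not> (\<exists>u. pendant E V v u \<or> pendant E V u v)}"
  have "N \<subseteq> V" "N \<noteq> {}" using assms contra unfolding N_def by blast+
  moreover have "N \<noteq> V"
  proof -
    obtain q z where "pendant E V q z" using exists_pendant by blast
    then have "q \<in> V" "q \<notin> N" using pendantD(1)[OF _ sym irr] unfolding N_def by blast+
    then show ?thesis by blast
  qed
  \<comment> \<open>Connectivity yields an exceptional \<open>v\<close> beside an unexceptional
    \<open>z\<close>. As a leaf, \<open>z\<close> would make its neighbour \<open>v\<close> a
    support; so \<open>z\<close> is a support itself.\<close>
  ultimately obtain v z where "v \<in> N" "z \<in> V - N" and vz: "(v, z) \<in> E"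
    using conn_crossing[OF conn, of N] by metis
  then have v: "v \<in> V" "\<And>u. \<not> pendant E V v u" "\<And>u. \<not> pendant E V u v"
    and z: "z \<in> V" "(\<exists>u. pendant E V z u) \<or> (\<exists>u. pendant E V u z)" unfolding N_def by blast+
  have "\<not> pendant E V z u" for u
  proof
    assume u: "pendant E V z u"
    then have "v = u" using pendantD(6)[OF u sym irr v(1) symD[OF sym vz]] by simp
    then show False using u v(3)[of z] by simp
  qed
  then obtain q where q: "pendant E V q z" using z(2) by metis
  note q' = pendantD[OF q sym irr]
  have "\<exists>d\<in>V. (v, d) \<in> E \<and> d \<noteq> z"
  proof (rule ccontr)
    assume "\<not> ?thesis"
    then have "y = z" if "y \<in> V" "(v, y) \<in> E" for y using that by blast
    then have "pendant E V v z" using v(1) z(1) vz by (intro pendantI)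
    then show False using v(2) by simp
  qed
  then obtain d where d: "d \<in> V" "(v, d) \<in> E" "d \<noteq> z" by blast
  have ne: "v \<noteq> z" "v \<noteq> d" using vz d(2) no_loop by auto
  have qv: "q \<noteq> v" using q v(2) by blast
  have qd: "q \<noteq> d"
    using q'(6)[OF v(1)] symD[OF sym d(2)] ne(1) by blast
  define E' where "E' = E - {(v, d), (d, v)}"
  have E'E: "E' \<subseteq> E" unfolding E'_def by blast
  have sym': "sym E'" using sym unfolding E'_def sym_def by blast
  have irr': "irrefl E'" using irr unfolding E'_def irrefl_def by blast
  have vz': "(v, z) \<in> E'" using vz d(3) ne unfolding E'_def by auto
  have zq': "(z, q) \<in> E'" using q'(4) ne d(3) unfolding E'_def by auto
  have v_not_bad: "\<not> bad X" if "v \<in> X" for X using bad_supports[of X v] that v(3) by blast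

  \<comment> \<open>In such a sun both \<open>v\<close> and \<open>q\<close> would be pendant at \<open>z\<close>.\<close>
  have two: False
    if A: "A \<subseteq> V" "sun E' A" "v \<in> A" "z \<in> A" "q \<in> A" and nosup: "\<And>l. \<not> pendant E' A l v" for A
  proof -
    have "finite A" using A(1) fin by (rule finite_subset)
    moreover have "card {v, z, q} = 3" using ne(1) qv q'(5) by auto
    moreover have "{v, z, q} \<subseteq> A" using A by blast
    ultimately have c: "3 \<le> card A" using card_mono[of A "{v, z, q}"] by simp
    obtain u where u: "pendant E' A v u" using sunD(4)[OF A(2) c A(3)] nosup by blast
    have "z = u" using pendantD(6)[OF u sym' irr' A(4) vz'] .
    moreover have "pendant E' A q z"
      using A symD[OF sym' zq'] q'(6) E'E by (intro pendantI) auto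
    ultimately show False using sunD(5)[OF A(2) c u] qv by blast
  qed

  \<comment> \<open>A violation at \<open>X\<close> forces \<open>X\<close> to be bad and the edge
    to split a non-sun component \<open>R\<close> into suns \<open>R1\<close> and \<open>R2\<close>.
    If \<open>z\<close> is outside \<open>X\<close>, then \<open>R1\<close> is a sun excluded by
    \<open>two\<close>; if \<open>z\<close> is in \<open>X\<close>, then \<open>R\<close> is
    absorbed into a factor of \<open>V\<close>.\<close>
  have small: "card (suns E' (V - X)) \<le> 2 * card X" if X: "X \<subseteq> V" "X \<noteq> {}" for X
  proof (rule ccontr)
    assume big: "\<not> ?thesis"
    have fW: "finite (V - X)" using fin by blast
    have fX: "finite X" using X(1) fin by (rule finite_subset)
    have many: "card (suns E (V - X)) + 2 \<le> card (suns E' (V - X))"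
      using big not_tight[OF X] by linarith
    obtain R R1 R2 where R: "R \<in> comps E (V - X)" "\<not> sun E R"
      and R12: "sun E R1" "sun E R2" "R1 \<inter> R2 = {}" "R1 \<union> R2 = R" "v \<in> R1" "d \<in> R2"
      and R12': "R1 \<in> suns E' R" "R2 \<in> suns E' R"
      and eq: "card (suns E' (V - X)) = card (suns E (V - X)) + 2"
      using card_suns_delete_edge[OF sym fW E'_def many] .
    have badX: "bad X" unfolding bad_def using X eq big by linarith
    have C1: "R1 \<in> comps E' R" "sun E' R1" and C2: "R2 \<in> comps E' R"
      using R12' unfolding suns_def by auto
    note R' = compsD[OF R(1)] and C1' = compsD[OF C1(1)] and C2' = compsD[OF C2]
    have vX: "v \<notin> X" using C1'(1) R'(1) R12(5) by blast
    have dR1: "d \<notin> R1" "v \<notin> R2" using R12 by blast+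
    \<comment> \<open>Deleting \<open>X\<close>, \<open>v\<close> and \<open>S\<close> leaves the
      suns of \<open>V - X\<close>, the sun \<open>R2\<close> and those of
      \<open>R1 - {v} - S\<close>. No bad set contains \<open>v\<close>, so the total has slack two;
      with the exact count for the bad set \<open>X\<close> this leaves \<open>2 * card S\<close>
      for the last group.\<close>
    have R1v: "fac E (R1 - {v})"
    proof (rule smaller_fac[OF sym])
      show "R1 - {v} \<subseteq> V" "R1 - {v} \<noteq> V \<or> \<not> E \<inter> V \<times> V \<subseteq> E"
        using C1'(1) R'(1) v(1) by blast+
      fix S assume S: "S \<subseteq> R1 - {v}"
      let ?T = "insert v S"
      have T: "?T \<subseteq> R" using S R12(4,5) by blast
      have fS: "finite S" using S C1'(1) R'(1) fin finite_subset[of S V] by blast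
      have "suns E (V - X) - {R} = suns E (V - X)" using R(2) unfolding suns_def by blast
      then have split: "card (suns E (V - X - ?T)) = card (suns E (V - X)) + card (suns E (R - ?T))"
        using card_suns_split[OF sym fW R(1) T] by simp
      have sub: "insert R2 (suns E (R1 - {v} - S)) \<subseteq> suns E (R - ?T)"
      proof (rule insert_subsetI)
        have "R2 \<in> comps E (R - ?T)"
        proof (rule compsI)
          show "R2 \<subseteq> R - ?T" using C2'(1) S R12(3) dR1(2) by blast
          show "conn E R2" by (rule sunD(2)[OF R12(2)])
          fix x y assume xy: "x \<in> R2" "y \<in> R - ?T" "(x, y) \<in> E"
          then have "(x, y) \<in> E'" using dR1(2) unfolding E'_def by blast
          then show "y \<in> R2" using C2'(4)[of x y] xy by blast
        qed (fact C2'(2))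
        then show "R2 \<in> suns E (R - ?T)" using R12(2) unfolding suns_def by blast
        show "suns E (R1 - {v} - S) \<subseteq> suns E (R - ?T)"
        proof
          fix C assume "C \<in> suns E (R1 - {v} - S)"
          then have C: "C \<in> comps E (R1 - {v} - S)" "sun E C" unfolding suns_def by auto
          note C' = compsD[OF C(1)]
          have "C \<in> comps E (R - ?T)"
          proof (rule compsI)
            show "C \<subseteq> R - ?T" using C'(1) C1'(1) by blast
            fix x y assume xy: "x \<in> C" "y \<in> R - ?T" "(x, y) \<in> E"
            have x: "x \<in> R1" "x \<noteq> v" "x \<noteq> d" using xy(1) C'(1) dR1(1) by blast+
            then have "(x, y) \<in> E'" using xy(3) unfolding E'_def by blast
            then have "y \<in> R1" using C1'(4)[of x y] x(1) xy(2) by blast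
            then show "y \<in> C" using C'(4)[of x y] xy by blast
          qed (fact C'(2) C'(3))+
          then show "C \<in> suns E (R - ?T)" using C(2) unfolding suns_def by blast
        qed
      qed
      have fin': "finite (suns E (R - ?T))" "finite (suns E (R1 - {v} - S))"
        using R'(1) C1'(1) fin finite_subset[of _ V] by (blast intro!: finite_suns)+
      have R2_notin: "R2 \<notin> suns E (R1 - {v} - S)"
      proof
        assume "R2 \<in> suns E (R1 - {v} - S)"
        then have "R2 \<subseteq> R1 - {v} - S" using compsD(1)[of R2 E] unfolding suns_def by blast
        then show False using dR1(1) R12(6) by blast
      qed
      have ge: "card (suns E (R1 - {v} - S)) + 1 \<le> card (suns E (R - ?T))"
        using card_mono[OF fin'(1) sub] card_insert_disjoint[OF fin'(2) R2_notin] by linarith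
      have XT: "X \<union> ?T \<subseteq> V" "X \<union> ?T \<noteq> {}" using X R'(1) T by blast+
      have "X \<inter> ?T = {}" using T R'(1) by blast
      then have "card (X \<union> ?T) = card X + card ?T" using fX fS by (intro card_Un_disjoint) auto
      moreover have "card ?T = card S + 1" using S fS by (subst card_insert_disjoint) auto
      moreover have "card (suns E (V - (X \<union> ?T))) + 2 \<le> 2 * card (X \<union> ?T)"
        using not_bad[OF XT] v_not_bad[of "X \<union> ?T"] by blast
      moreover have "V - (X \<union> ?T) = V - X - ?T" by blast
      ultimately have "card (suns E (V - X - ?T)) + 2 \<le> 2 * card X + 2 * card S + 2" by simp
      then show "card (suns E (R1 - {v} - S)) \<le> 2 * card S"
        using split ge badD(3)[OF badX] by linarith
    qed simp
    show False
    proof (cases "z \<in> X")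
      case False
      have zR1: "z \<in> R1"
      proof -
        have "z \<in> R" using R'(4)[of v z] R12(4,5) vz z(1) False by blast
        then show ?thesis using C1'(4)[of v z] R12(5) vz' by blast
      qed
      \<comment> \<open>Bad sets consist of supports, and the leaf \<open>q\<close> is not a
        support.\<close>
      have qX: "q \<notin> X"
        using bad_supports[OF badX, of q] not_pendant_support[OF q] by blast
      have qR1: "q \<in> R1"
      proof -
        have "q \<in> R" using R'(4)[of z q] R12(4) zR1 q'(1,4) qX by blast
        then show ?thesis using C1'(4)[of z q] zR1 zq' by blast
      qed
      show False
      proof (rule two[OF _ C1(2) R12(5) zR1 qR1])
        show "R1 \<subseteq> V" using C1'(1) R'(1) by blast
        show "\<not> pendant E' R1 l v" for l
        proof
          assume l: "pendant E' R1 l v"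
          note l' = pendantD[OF l sym' irr']
          \<comment> \<open>A leaf at \<open>v\<close> would be isolated in \<open>R1 - {v}\<close>,
            which has a factor.\<close>
          have "nbrs E (R1 - {v}) l \<subseteq> {v}"
          proof
            fix y assume y: "y \<in> nbrs E (R1 - {v}) l"
            then have "(l, y) \<in> E'" using l'(1,5) dR1(1) unfolding nbrs_def E'_def by blast
            then show "y \<in> {v}" using l'(6)[of y] y unfolding nbrs_def by blast
          qed
          then show False using fac_pendant[OF R1v sym, of l v] l'(1,5) by blast
        qed
      qed
    next
      case True
      let ?K = "suns E (V - X)"
      obtain C w where C: "C \<in> ?K" "w \<in> C" "(z, w) \<in> E"
        and fac1: "fac E (X - {z} \<union> \<Union>(?K - {C}))"
        using bad_assign[OF badX True] .
      have CC: "C \<in> comps E (V - X)" "sun E C" using C(1) unfolding suns_def by auto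
      have CR: "C \<inter> R = {}" using comps_disjoint[OF CC(1) R(1)] CC(2) R(2) by blast
      have CV: "C \<subseteq> V - X" by (rule compsD(1)[OF CC(1)])
      have vR: "v \<in> R" using R12(4,5) by blast
      have zR: "z \<notin> R" using R'(1) True by blast
      \<comment> \<open>Since \<open>z\<close> is assigned only the sun \<open>C\<close>, its path
        can continue through \<open>v\<close> into \<open>R2\<close> at \<open>d\<close>. Together
        with the factor of \<open>R1 - {v}\<close> this uses up all of \<open>R\<close>.\<close>
      have "fac E (C \<union> set [z, v] \<union> R2)"
      proof (rule fac_join[OF sym CC(2) R12(2) C(2) R12(6)])
        show "dpath E [z, v]" using symD[OF sym vz] ne(1) unfolding dpath_def by auto
        show "(w, hd [z, v]) \<in> E" using symD[OF sym C(3)] by simp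
        show "(last [z, v], d) \<in> E" using d(2) by simp
        show "C \<inter> R2 = {}" using CR C2'(1) by blast
        show "C \<inter> set [z, v] = {}" using CV CR True vR by auto
        show "R2 \<inter> set [z, v] = {}" using C2'(1) zR dR1(2) by auto
      qed
      moreover have "(C \<union> set [z, v] \<union> R2) \<inter> (R1 - {v}) = {}"
        using CR C1'(1) R12(3) zR by auto
      ultimately have "fac E ((C \<union> set [z, v] \<union> R2) \<union> (R1 - {v}))" by (rule fac_Un[OF _ R1v])
      moreover have "(C \<union> set [z, v] \<union> R2) \<union> (R1 - {v}) = insert z (C \<union> R)" using R12(4,5) by auto
      ultimately have "fac E (insert z (C \<union> R))" by simp
      moreover have "insert z (C \<union> R) \<inter> (X - {z} \<union> \<Union>(?K - {C})) = {}"
      proof -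
        have "\<Union>{C, R} \<inter> \<Union>(?K - {C}) = {}"
          using CC(1) R suns_subset_comps[of E "V - X"]
          by (intro Union_comps_disjoint[of _ E "V - X"]) (auto simp: suns_def)
        moreover have "\<Union>(?K - {C}) \<inter> X = {}" using compsD(1)[of _ E "V - X"] unfolding suns_def by blast
        ultimately show ?thesis using CV R'(1) True by auto
      qed
      ultimately have "fac E (insert z (C \<union> R) \<union> (X - {z} \<union> \<Union>(?K - {C})))"
        by (rule fac_Un[OF _ fac1])
      moreover have "insert z (C \<union> R) \<union> (X - {z} \<union> \<Union>(?K - {C})) = X \<union> \<Union>(insert R ?K)"
        using True C(1) by auto
      ultimately have fac2: "fac E (X \<union> \<Union>(insert R ?K))" by simp
      let ?N = "comps E (V - X) - insert R ?K"
      have "fac E (\<Union>?N)"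
        using bad_nonsun_fac[OF badX] by (intro fac_Union_comps[OF fW]) (auto simp: suns_def)
      moreover have disj: "\<Union>(insert R ?K) \<inter> \<Union>?N = {}"
        using R(1) suns_subset_comps[of E "V - X"] by (intro Union_comps_disjoint[of _ E "V - X"]) auto
      have U: "\<Union>(comps E (V - X)) = V - X" using Union_comps[OF fW sym] .
      have "(X \<union> \<Union>(insert R ?K)) \<inter> \<Union>?N = {}" using disj U by blast
      ultimately have "fac E (X \<union> \<Union>(insert R ?K) \<union> \<Union>?N)" by (rule fac_Un[OF fac2])
      moreover have "X \<union> \<Union>(insert R ?K) \<union> \<Union>?N = V"
      proof -
        have "insert R ?K \<union> ?N = comps E (V - X)" using R(1) suns_subset_comps[of E "V - X"] by blast
        then have "\<Union>(insert R ?K) \<union> \<Union>?N = V - X" using U by (metis Union_Un_distrib)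
        then show ?thesis using X(1) by blast
      qed
      ultimately show False using nofac by simp
    qed
  qed
  obtain A where A: "A \<in> comps E' V" "sun E' A"
    using delete_edge_sun[OF v(1) d(1,2) E'_def small] .
  note A' = compsD[OF A(1)]
  show False
  proof (cases "v \<in> A")
    case True
    have zA: "z \<in> A" using A'(4)[OF True z(1) vz'] .
    have qA: "q \<in> A" using A'(4)[OF zA q'(1) zq'] .
    show False
    proof (rule two[OF A'(1) A(2) True zA qA])
      show "\<not> pendant E' A l v" for l
      proof
        assume l: "pendant E' A l v"
        note l' = pendantD[OF l sym' irr']
        have ld: "l \<noteq> d" using l'(3) unfolding E'_def by blast
        have "pendant E V l v"
        proof (rule pendantI)
          show "l \<in> V" "v \<in> V" "(l, v) \<in> E" using l'(1,3) A'(1) v(1) E'E by blast+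
          fix y assume y: "y \<in> V" "(l, y) \<in> E"
          then have y': "(l, y) \<in> E'" using l'(5) ld unfolding E'_def by blast
          then show "y = v" using A'(4)[OF l'(1) y(1)] l'(6)[of y] by blast
        qed
        then show False using v(3) by blast
      qed
    qed
  next
    case False
    then obtain x y where xy: "x \<in> A" "y \<in> V - A" "(x, y) \<in> E"
      using conn_crossing[OF conn A'(1,2)] v(1) by metis
    then have "(x, y) \<notin> E'" using A'(4) by blast
    then have "x = d" using xy False unfolding E'_def by blast
    moreover have "E' = E - {(d, v), (v, d)}" unfolding E'_def by auto
    ultimately have "bad {v}" using sun_side_bad[OF _ A] xy(1) v(1) False by blast
    then show False using v_not_bad by blast
  qed
qed

text \<open>At a support \<open>z\<close> the partner given by \<open>bad_flex\<close> for
  \<open>{z}\<close> can only be the leaf; the same pair serves when the prescribed vertex is the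
  leaf.\<close>

lemma is_sun: "sun E V"
  unfolding sun_def
proof (intro conjI ballI impI allI)
  show "V \<noteq> {}" using card3 by auto
  show "conn E V" by (rule conn)
  show "\<exists>u. pendant E V v u \<or> pendant E V u v" if "v \<in> V" for v using all_pendant[OF that] .
  show "q = q'" if "pendant E V q z \<and> pendant E V q' z" for z q q'
    using pendant_only_sun[of q z "{q'}"] pendant_sun[of q' z] that by blast
  have support: "\<exists>u\<in>V. u \<noteq> z \<and> (z, u) \<in> E \<and> fac E (V - {z, u}) \<and> u = q" if p: "pendant E V q z" for q z
  proof -
    obtain w where w: "{w} \<in> suns E (V - {z})" "(z, w) \<in> E" "fac E (V - {z, w})"
      using bad_flex[OF pendant_bad[OF p], of z] by auto
    then show ?thesis using pendant_only_sun[OF p w(1)] pendantD(1,5)[OF p sym irr] by auto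
  qed
  show "V = {v} \<or> (\<exists>u\<in>V. u \<noteq> v \<and> (v, u) \<in> E \<and> fac E (V - {v, u}))" if v: "v \<in> V" for v
  proof -
    consider u where "pendant E V v u" | u where "pendant E V u v" using all_pendant[OF v] by blast
    then show ?thesis
    proof cases
      case 1
      note p = pendantD[OF 1 sym irr]
      have "fac E (V - {u, v})" using support[OF 1] by blast
      then have "fac E (V - {v, u})" by (simp add: insert_commute)
      then show ?thesis using p(2,3,5) by (intro disjI2 bexI[of _ u]) auto
    next
      case 2
      then obtain w where "w \<in> V" "w \<noteq> v" "(v, w) \<in> E" "fac E (V - {v, w})"
        using support[OF 2] by metis
      then show ?thesis by (intro disjI2 bexI[of _ w]) simp_all
    qed
  qed
qed

end

text \<open>The measure, vertices plus ordered adjacent pairs, drops both for proper vertex subsets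
  and for edge deletions. Connected graphs with one or two vertices are suns directly.\<close>

theorem fac_or_sun:
  assumes "sym E" "irrefl E" "finite V" "V \<noteq> {}" "conn E V"
    and "\<And>X. X \<subseteq> V \<Longrightarrow> X \<noteq> {} \<Longrightarrow> card (suns E (V - X)) \<le> 2 * card X"
  shows "fac E V \<or> sun E V"
  using assms
proof (induction "card V + card (E \<inter> V \<times> V)" arbitrary: E V rule: less_induct)
  case less
  show ?case
  proof (cases "card V \<ge> 3")
    case True
    show ?thesis
    proof (rule ccontr)
      assume no: "\<not> ?thesis"
      have "factorless_graph E V"
      proof
        show "sym E" "irrefl E" "finite V" "conn E V" "3 \<le> card V" "\<not> fac E V"
          using less.prems True no by auto
        show "card (suns E (V - X)) \<le> 2 * card X" if "X \<subseteq> V" "X \<noteq> {}" for X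
          using less.prems(6)[OF that] .
        fix E' :: "('a \<times> 'a) set" and V' :: "'a set"
        assume a: "sym E'" "E' \<subseteq> E" "V' \<subseteq> V" "V' \<noteq> {}" "conn E' V'"
          and strict: "V' \<noteq> V \<or> \<not> E \<inter> V \<times> V \<subseteq> E'"
          and h: "\<And>X. X \<subseteq> V' \<Longrightarrow> X \<noteq> {} \<Longrightarrow> card (suns E' (V' - X)) \<le> 2 * card X"
        have fE: "finite (E \<inter> V \<times> V)" using less.prems(3) by simp
        have sub: "E' \<inter> V' \<times> V' \<subseteq> E \<inter> V \<times> V" using a(2,3) by auto
        have "card V' + card (E' \<inter> V' \<times> V') < card V + card (E \<inter> V \<times> V)"
        proof (cases "V' = V")
          case True
          then have "E' \<inter> V' \<times> V' \<subset> E \<inter> V \<times> V" using sub strict by auto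
          then show ?thesis using psubset_card_mono[OF fE] True by simp
        next
          case False
          then have "card V' < card V" using psubset_card_mono[OF less.prems(3)] a(3) by blast
          then show ?thesis using card_mono[OF fE sub] by linarith
        qed
        moreover have "irrefl E'" using less.prems(2) a(2) unfolding irrefl_def by blast
        moreover have "finite V'" using a(3) less.prems(3) by (rule finite_subset)
        ultimately show "fac E' V' \<or> sun E' V'" using less.hyps a h by blast
      qed
      then show False using factorless_graph.is_sun no by blast
    qed
  next
    case False
    have "V = {v} \<or> (\<exists>u\<in>V. u \<noteq> v \<and> (v, u) \<in> E \<and> fac E (V - {v, u}))" if v: "v \<in> V" for v
    proof (cases "V = {v}")
      case single: False
      then obtain x y where xy: "x \<in> {v}" "y \<in> V - {v}" "(x, y) \<in> E"
        using conn_crossing[OF less.prems(5), of "{v}"] v by auto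
      have "card {v, y} = 2" using xy by auto
      then have "V = {v, y}"
        using card_seteq[OF less.prems(3), of "{v, y}"] v xy(2) False by auto
      then have "fac E (V - {v, y})" using fac.fac_empty[of E] by simp
      then show ?thesis using xy by (intro disjI2 bexI[of _ y]) auto
    qed simp
    then have "sun E V" unfolding sun_def using less.prems(4,5) False by blast
    then show ?thesis by blast
  qed
qed

subsection \<open>Toughness and path factors of graphs\<close>

definition adj :: "'a graph \<Rightarrow> ('a \<times> 'a) set" where
  "adj G = {(x, y). {x, y} \<in> edges G}"

lemma sym_adj: "sym (adj G)"
  unfolding adj_def sym_def by (simp add: insert_commute)

lemma rtrancl_crossing:
  "(a, b) \<in> r\<^sup>* \<Longrightarrow> a \<in> A \<Longrightarrow> b \<notin> A \<Longrightarrow> \<exists>x y. (a, x) \<in> r\<^sup>* \<and> x \<in> A \<and> y \<notin> A \<and> (x, y) \<in> r"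
  by (induction rule: rtrancl_induct) blast+

text \<open>Reachability classes fit the cut formulation because a walk from inside a subset to
  outside must cross its boundary.\<close>

lemma components_eq_comps:
  assumes "\<And>e. e \<in> edges H \<Longrightarrow> e \<subseteq> verts H"
  shows "components H = comps (adj H) (verts H)"
proof -
  define cl where "cl u = {v \<in> verts H. (u, v) \<in> (adj H)\<^sup>*}" for u
  have cl: "components H = cl ` verts H"
    unfolding components_def quotient_def reach_rel_def cl_def adj_def by auto
  have inV: "x \<in> verts H" "y \<in> verts H" if "(x, y) \<in> adj H" for x y
    using assms[of "{x, y}"] that unfolding adj_def by auto
  have sym': "sym ((adj H)\<^sup>*)" by (rule sym_rtrancl[OF sym_adj])
  have cl_comp: "cl u \<in> comps (adj H) (verts H)" if u: "u \<in> verts H" for u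
  proof (rule compsI)
    show "cl u \<subseteq> verts H" "cl u \<noteq> {}" using u unfolding cl_def by auto
    show "y \<in> cl u" if "x \<in> cl u" "y \<in> verts H" "(x, y) \<in> adj H" for x y
      using that unfolding cl_def by (auto intro: rtrancl_into_rtrancl)
    show "conn (adj H) (cl u)" unfolding conn_def
    proof (intro allI impI)
      fix A assume A: "A \<subseteq> cl u" "A \<noteq> {} \<and> A \<noteq> cl u"
      then obtain a b where ab: "a \<in> A" "b \<in> cl u" "b \<notin> A" by blast
      have a: "(u, a) \<in> (adj H)\<^sup>*" and b: "(u, b) \<in> (adj H)\<^sup>*"
        using ab A(1) unfolding cl_def by auto
      have "(a, b) \<in> (adj H)\<^sup>*" using symD[OF sym' a] b by (rule rtrancl_trans)
      then obtain x y where xy: "(a, x) \<in> (adj H)\<^sup>*" "x \<in> A" "y \<notin> A" "(x, y) \<in> adj H"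
        using rtrancl_crossing ab(1,3) by metis
      have "(u, y) \<in> (adj H)\<^sup>*" using a xy(1,4) by (meson rtrancl_trans rtrancl_into_rtrancl)
      then have "y \<in> cl u" using inV(2)[OF xy(4)] unfolding cl_def by blast
      then show "\<exists>x\<in>A. \<exists>y\<in>cl u - A. (x, y) \<in> adj H" using xy by blast
    qed
  qed
  have "C \<in> cl ` verts H" if C: "C \<in> comps (adj H) (verts H)" for C
  proof -
    obtain u where u: "u \<in> C" "u \<in> verts H" using compsD(1,2)[OF C] by blast
    then have "u \<in> C \<inter> cl u" unfolding cl_def by blast
    then have "C = cl u" using comps_disjoint[OF C cl_comp[OF u(2)]] by blast
    then show ?thesis using u(2) by blast
  qed
  then show ?thesis unfolding cl using cl_comp by blast
qed

lemma num_components_delete_verts: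
  assumes "simple_graph G"
  shows "num_components (delete_verts G X) = card (comps (adj G) (verts G - X))"
proof -
  let ?H = "delete_verts G X"
  have v: "verts ?H = verts G - X" and e: "edges ?H = {e \<in> edges G. e \<subseteq> verts G - X}"
    unfolding delete_verts_def induced_subgraph_def by auto
  have "components ?H = comps (adj ?H) (verts ?H)" by (rule components_eq_comps) (auto simp: v e)
  also have "\<dots> = comps (adj G) (verts G - X)"
    unfolding v by (rule comps_cong) (auto simp: adj_def e)
  finally show ?thesis unfolding num_components_def by simp
qed

lemma complete_graph_comps:
  assumes "complete_graph G" "S \<subseteq> verts G"
  shows "card (comps (adj G) S) \<le> 1"
proof (cases "S = {}")
  case True
  then have "comps (adj G) S = {}" unfolding comps_def by blast
  then show ?thesis by simp
next
  case False
  have "conn (adj G) S" unfolding conn_def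
  proof (intro allI impI)
    fix A assume A: "A \<subseteq> S" "A \<noteq> {} \<and> A \<noteq> S"
    then obtain x y where xy: "x \<in> A" "y \<in> S - A" by blast
    then have "x \<in> verts G" "y \<in> verts G" "x \<noteq> y" using A(1) assms(2) by blast+
    then have "(x, y) \<in> adj G" using assms(1) unfolding complete_graph_def adj_def by blast
    then show "\<exists>x\<in>A. \<exists>y\<in>S - A. (x, y) \<in> adj G" using xy by blast
  qed
  then show ?thesis using comps_conn False by fastforce
qed

lemma toughness_comps:
  assumes "simple_graph G" "X \<subseteq> verts G" "2 \<le> card (comps (adj G) (verts G - X))"
  shows "toughness G \<le> ereal (real (card X) / real (card (comps (adj G) (verts G - X))))"
proof -
  have nc: "\<not> complete_graph G" using complete_graph_comps[of G "verts G - X"] assms(3) by force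
  let ?S = "{ereal (real (card X) / real (num_components (delete_verts G X))) |X.
                X \<subseteq> verts G \<and> 2 \<le> num_components (delete_verts G X)}"
  have "?S \<subseteq> (\<lambda>X. ereal (real (card X) / real (num_components (delete_verts G X)))) ` Pow (verts G)"
    by blast
  moreover have "finite (Pow (verts G))" using assms(1) unfolding simple_graph_def by simp
  ultimately have "finite ?S" by (meson finite_imageI finite_subset)
  moreover have "ereal (real (card X) / real (card (comps (adj G) (verts G - X)))) \<in> ?S"
    using assms(2,3) num_components_delete_verts[OF assms(1)] by auto
  ultimately show ?thesis unfolding toughness_def using nc by (simp add: Min_le)
qed

lemma few_comps:
  assumes G: "simple_graph G" "k_connected (n + r + 2) G"
    and tough: "toughness G > ereal (real (n + r + 2) / real (2 * (r + 2)))"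
    and W: "W \<subseteq> verts G" "card W = n" and X: "X \<subseteq> verts G - W" "X \<noteq> {}"
  shows "card (comps (adj G) (verts G - W - X)) < 2 * card X"
proof -
  have fin: "finite (verts G)" using G(1) unfolding simple_graph_def by blast
  have fX: "finite X" "finite W" using X W fin finite_subset by blast+
  have Y: "W \<union> X \<subseteq> verts G" using W X by blast
  have VY: "verts G - (W \<union> X) = verts G - W - X" by blast
  have cY: "card (W \<union> X) = n + card X"
    using card_Un_disjoint[OF fX(2,1)] X(1) W(2) by blast
  have X1: "1 \<le> card X" using X(2) fX(1) by (simp add: Suc_leI card_gt_0_iff)
  let ?c = "card (comps (adj G) (verts G - W - X))"
  show ?thesis
  proof (cases "card X < r + 2")
    case True
    then have "connected_graph (delete_verts G (W \<union> X))"
      using G(2) Y cY unfolding k_connected_def by simp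
    then have "?c = 1"
      using num_components_delete_verts[OF G(1), of "W \<union> X"] VY unfolding connected_graph_def by simp
    then show ?thesis using X1 by simp
  next
    case False
    show ?thesis
    proof (rule ccontr)
      assume "\<not> ?thesis"
      then have ge: "2 * card X \<le> ?c" by simp
      then have "toughness G \<le> ereal (real (n + card X) / real ?c)"
        using toughness_comps[OF G(1) Y] VY cY X1 by simp
      then have "ereal (real (n + r + 2) / real (2 * (r + 2))) < ereal (real (n + card X) / real ?c)"
        using tough by (rule less_le_trans[rotated])
      then have "real (n + r + 2) / real (2 * (r + 2)) < real (n + card X) / real ?c" by simp
      also have "\<dots> \<le> real (n + card X) / real (2 * card X)"
        using ge X1 by (intro divide_left_mono) auto
      also have "\<dots> \<le> real (n + r + 2) / real (2 * (r + 2))"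
      proof -
        \<comment> \<open>After cross-multiplying, the monotonicity of
          \<open>(n + x) / (2 * x)\<close> reduces to this inequality.\<close>
        have "n * (r + 2) \<le> n * card X" using False by (intro mult_le_mono2) simp
        then have "(n + card X) * (2 * (r + 2)) \<le> (n + r + 2) * (2 * card X)"
          by (simp add: algebra_simps)
        then have "real (n + card X) * real (2 * (r + 2)) \<le> real (n + r + 2) * real (2 * card X)"
          by (metis of_nat_le_iff of_nat_mult)
        then show ?thesis using X1 by (simp add: divide_le_eq pos_le_divide_eq mult.commute)
      qed
      finally show False by simp
    qed
  qed
qed

lemma fac_path_set:
  "fac E V \<Longrightarrow> \<exists>P. (\<forall>p\<in>P. dpath E p \<and> 3 \<le> length p) \<and> (\<Union>p\<in>P. set p) = V \<and>
    (\<forall>p\<in>P. \<forall>p'\<in>P. set p \<inter> set p' \<noteq> {} \<longrightarrow> p = p')"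
proof (induction rule: fac.induct)
  case (fac_path V p)
  then obtain P where P: "\<forall>p\<in>P. dpath E p \<and> 3 \<le> length p" "(\<Union>p\<in>P. set p) = V"
    "\<forall>p\<in>P. \<forall>p'\<in>P. set p \<inter> set p' \<noteq> {} \<longrightarrow> p = p'" by blast
  have "set p \<inter> set p' = {}" if "p' \<in> P" for p' using that P(2) fac_path.hyps(4) by blast
  then show ?case using P fac_path.hyps(2,3) by (intro exI[of _ "insert p P"]) auto
qed (auto intro!: exI[of _ "{}"])

lemma conn_list:
  assumes "sym R" "\<And>i. Suc i < length p \<Longrightarrow> (p ! i, p ! Suc i) \<in> R"
  shows "conn R (set p)"
  unfolding conn_def
proof (intro allI impI, rule ccontr)
  fix A assume A: "A \<subseteq> set p" "A \<noteq> {} \<and> A \<noteq> set p" and no: "\<not> (\<exists>x\<in>A. \<exists>y\<in>set p - A. (x, y) \<in> R)"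
  have step: "p ! i \<in> A \<longleftrightarrow> p ! Suc i \<in> A" if "Suc i < length p" for i
  proof -
    have "p ! i \<in> set p" "p ! Suc i \<in> set p" using that by simp_all
    then show ?thesis using no assms(2)[OF that] symD[OF assms(1) assms(2)[OF that]] by blast
  qed
  have "p ! i \<in> A \<longleftrightarrow> p ! 0 \<in> A" if "i < length p" for i
    using that by (induction i) (auto simp: step)
  then have "A = set p \<or> A = {}" using A(1) by (auto simp: in_set_conv_nth) (metis in_set_conv_nth subsetD)+
  then show False using A(2) by blast
qed

text \<open>Take the consecutive pairs of the paths as edges. The paths are pairwise disjoint, so
  their vertex sets are exactly the components and each induces only its own path.\<close>

lemma fac_imp_path_ge_factor:
  assumes "fac E (verts H)"
    and E: "\<And>x y. x \<in> verts H \<Longrightarrow> y \<in> verts H \<Longrightarrow> (x, y) \<in> E \<Longrightarrow> {x, y} \<in> edges H"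
  obtains F where "path_ge_factor 3 F H"
proof -
  obtain P where P': "\<forall>p\<in>P. dpath E p \<and> 3 \<le> length p" "(\<Union>p\<in>P. set p) = verts H"
    "\<forall>p\<in>P. \<forall>p'\<in>P. set p \<inter> set p' \<noteq> {} \<longrightarrow> p = p'"
    using fac_path_set[OF assms(1)] by (elim exE conjE)
  have P: "dpath E p \<and> 3 \<le> length p"
    "p' \<in> P \<Longrightarrow> set p \<inter> set p' \<noteq> {} \<Longrightarrow> p = p'" if "p \<in> P" for p p'
    using P' that by simp_all
  define pe where "pe p = {{p ! i, p ! Suc i} |i. Suc i < length p}" for p :: "'a list"
  define F where "F = Graph (verts H) (\<Union>p\<in>P. pe p)"
  have vF: "verts F = verts H" and eF: "edges F = (\<Union>p\<in>P. pe p)" unfolding F_def by auto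
  have pe_sub: "e \<subseteq> set p" "e \<noteq> {}" if "e \<in> pe p" for e p using that unfolding pe_def by auto
  have PV: "set p \<subseteq> verts H" if "p \<in> P" for p using that P'(2) by blast
  have suc: "(p ! i, p ! Suc i) \<in> E" if "p \<in> P" "Suc i < length p" for p i
    using P(1)[OF that(1)] that(2) unfolding dpath_def successively_conv_nth by blast
  have "edges F \<subseteq> edges H"
  proof
    fix e assume "e \<in> edges F"
    then obtain p i where p: "p \<in> P" "Suc i < length p" "e = {p ! i, p ! Suc i}"
      unfolding eF pe_def by blast
    then have "p ! i \<in> verts H" "p ! Suc i \<in> verts H" using PV[OF p(1)] by auto
    then show "e \<in> edges H" using E suc[OF p(1,2)] p(3) by blast
  qed
  then have span: "spanning_subgraph F H" unfolding spanning_subgraph_def vF by simp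
  have "components F = comps (adj F) (verts F)"
  proof (rule components_eq_comps)
    fix e assume "e \<in> edges F"
    then obtain p where "p \<in> P" "e \<in> pe p" unfolding eF by blast
    then show "e \<subseteq> verts F" using pe_sub(1) PV vF by blast
  qed
  then have cF: "components F = comps (adj F) (verts H)" unfolding vF .
  have pcomp: "set p \<in> comps (adj F) (verts H)" if p: "p \<in> P" for p
  proof (rule compsI)
    show "set p \<subseteq> verts H" by (rule PV[OF p])
    show "set p \<noteq> {}" using P(1)[OF p] by auto
    show "conn (adj F) (set p)"
      using p by (intro conn_list[OF sym_adj]) (auto simp: adj_def eF pe_def)
    fix x y assume xy: "x \<in> set p" "y \<in> verts H" "(x, y) \<in> adj F"
    then obtain p' where p': "p' \<in> P" "{x, y} \<in> pe p'" unfolding adj_def eF by blast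
    then have "{x, y} \<subseteq> set p'" using pe_sub(1) by blast
    moreover then have "p = p'" using P(2)[OF p p'(1)] xy(1) by blast
    ultimately show "y \<in> set p" by blast
  qed
  have comp: "\<exists>p\<in>P. C = set p" if C: "C \<in> components F" for C
  proof -
    have C': "C \<in> comps (adj F) (verts H)" using C cF by simp
    obtain v where v: "v \<in> C" "v \<in> verts H" using compsD(1,2)[OF C'] by blast
    then obtain p where p: "p \<in> P" "v \<in> set p" using P'(2) by blast
    then have "C = set p" using comps_disjoint[OF C' pcomp[OF p(1)]] v(1) by blast
    then show ?thesis using p(1) by blast
  qed
  have path: "path_graph (induced_subgraph F (set p))" if p: "p \<in> P" for p
  proof -
    have "edges (induced_subgraph F (set p)) = pe p"
    proof
      show "pe p \<subseteq> edges (induced_subgraph F (set p))"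
        using p pe_sub(1) unfolding induced_subgraph_def eF by auto
      show "edges (induced_subgraph F (set p)) \<subseteq> pe p"
      proof
        fix e assume "e \<in> edges (induced_subgraph F (set p))"
        then obtain p' where p': "p' \<in> P" "e \<in> pe p'" "e \<subseteq> set p"
          unfolding induced_subgraph_def eF by auto
        then have "p = p'" using P(2)[OF p p'(1)] pe_sub[OF p'(2)] by blast
        then show "e \<in> pe p" using p'(2) by simp
      qed
    qed
    moreover have "verts (induced_subgraph F (set p)) = set p"
      using PV[OF p] unfolding induced_subgraph_def vF by auto
    ultimately show ?thesis
      unfolding path_graph_def pe_def using P(1)[OF p] unfolding dpath_def by blast
  qed
  have card: "3 \<le> card (set p)" if "p \<in> P" for p
    using P(1)[OF that] unfolding dpath_def by (simp add: distinct_card)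
  have "path_ge_factor 3 F H"
    unfolding path_ge_factor_def path_factor_def
  proof (intro conjI ballI)
    show "spanning_subgraph F H" by (rule span)
    fix C assume "C \<in> components F"
    then obtain p where p: "p \<in> P" "C = set p" using comp by blast
    show "path_graph (induced_subgraph F C)" using path[OF p(1)] p(2) by simp
    show "3 \<le> card C" using card[OF p(1)] p(2) by simp
    then show "2 \<le> card C" by simp
  qed
  then show thesis by (rule that)
qed

section \<open>Edge deletion under a strict bound on components\<close>

lemma conn_insert:
  assumes "sym E" "conn E W" "d \<in> W" "(u, d) \<in> E"
  shows "conn E (insert u W)"
  unfolding conn_def
proof (intro allI impI)
  fix A assume A: "A \<subseteq> insert u W" "A \<noteq> {} \<and> A \<noteq> insert u W"
  show "\<exists>x\<in>A. \<exists>y\<in>insert u W - A. (x, y) \<in> E"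
  proof (cases "A \<inter> W = {} \<or> A \<inter> W = W")
    case True
    then have "u \<in> A \<and> d \<notin> A \<or> d \<in> A \<and> u \<notin> A" using A assms(3) by blast
    then show ?thesis using assms(3,4) symD[OF assms(1,4)] by blast
  next
    case False
    then obtain x y where "x \<in> A \<inter> W" "y \<in> W - A \<inter> W" "(x, y) \<in> E"
      using conn_crossing[OF assms(2), of "A \<inter> W"] by blast
    then show ?thesis by blast
  qed
qed

lemma conn_of_card_comps:
  assumes "finite W" "sym E" "card (comps E W) < 2"
  shows "conn E W"
proof (cases "W = {}")
  case False
  then obtain w where "w \<in> W" by blast
  then obtain C where C: "C \<in> comps E W" using comps_cover[OF assms(1,2)] by metis
  have "comps E W = {C}"
    using card_seteq[OF finite_comps[OF assms(1)], of "{C}" E] C assms(3) by simp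
  then have "W = C" using Union_comps[OF assms(1,2)] by simp
  then show ?thesis using compsD(3)[OF C] by simp
qed (simp add: conn_def)

text \<open>One-element sets \<open>X\<close> make each \<open>V - {x}\<close> connected, which
  gives every vertex a neighbour other than a prescribed one. For general \<open>X\<close>,
  strictness in \<open>few\<close> absorbs the one component that the deletion may add.\<close>

lemma fac_delete_edge:
  assumes "sym E" "irrefl E" "finite V" "3 \<le> card V" "u \<in> V" "v \<in> V" "(u, v) \<in> E"
    and few: "\<And>X. X \<subseteq> V \<Longrightarrow> X \<noteq> {} \<Longrightarrow> card (comps E (V - X)) < 2 * card X"
    and E': "E' = E - {(u, v), (v, u)}"
  shows "fac E' V"
proof -
  have conn1: "conn E (V - {x})" if "x \<in> V" for x
    using few[of "{x}"] that assms(1,3) by (intro conn_of_card_comps) auto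
  have no_pendant: "\<exists>y\<in>V. y \<noteq> z \<and> (q, y) \<in> E" if q: "q \<in> V" and z: "z \<in> V" "q \<noteq> z" for q z
  proof -
    have "{q} \<noteq> V - {z}"
    proof
      assume "{q} = V - {z}"
      then have "V = {q, z}" using z by blast
      then have "card V \<le> 2" using card_insert_le_m1[of 2 "{z}" q] by simp
      then show False using assms(4) by simp
    qed
    then obtain x y where "x \<in> {q}" "y \<in> V - {z} - {q}" "(x, y) \<in> E"
      using conn_crossing[OF conn1[OF z(1)], of "{q}"] q z(2) by auto
    then show ?thesis by blast
  qed
  have sym': "sym E'" using assms(1) unfolding E' sym_def by blast
  have irr': "irrefl E'" using assms(2) unfolding E' irrefl_def by blast
  have uv: "u \<noteq> v" using assms(2,7) unfolding irrefl_def by blast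
  \<comment> \<open>The deleted edge is incident with \<open>u\<close>, so \<open>V - {u}\<close>
    stays connected; \<open>u\<close> is attached again through a neighbour \<open>d\<close> other
    than \<open>v\<close>.\<close>
  have "conn E' V"
  proof -
    obtain d where d: "d \<in> V" "d \<noteq> v" "(u, d) \<in> E" using no_pendant[OF assms(5,6) uv] by blast
    have du: "d \<noteq> u" using d(3) assms(2) unfolding irrefl_def by blast
    have "conn E' (V - {u})"
      by (rule conn_mono[OF conn1[OF assms(5)]]) (auto simp: E')
    then have "conn E' (insert u (V - {u}))"
      using d du uv by (intro conn_insert[OF sym', of _ d]) (auto simp: E')
    then show ?thesis using assms(5) by (simp add: insert_absorb)
  qed
  moreover have "card (suns E' (V - X)) \<le> 2 * card X" if X: "X \<subseteq> V" "X \<noteq> {}" for X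
  proof -
    have fW: "finite (V - X)" using assms(3) by blast
    have "card (suns E' (V - X)) \<le> card (comps E' (V - X))"
      by (rule card_mono[OF finite_comps[OF fW] suns_subset_comps])
    then show ?thesis
      using card_comps_delete_edge[OF assms(1) fW E'] few[OF X] by linarith
  qed
  moreover have "V \<noteq> {}" using assms(5) by blast
  ultimately have "fac E' V \<or> sun E' V" using fac_or_sun[OF sym' irr' assms(3)] by blast
  moreover have "\<not> sun E' V"
  proof
    assume "sun E' V"
    then obtain q z where q: "pendant E' V q z" "q \<noteq> u" "q \<noteq> v"
      using sun_pendant_avoiding[OF sym' irr' _ assms(4)] by metis
    note q' = pendantD[OF q(1) sym' irr']
    obtain y where y: "y \<in> V" "y \<noteq> z" "(q, y) \<in> E" using no_pendant[OF q'(1,2,5)] by blast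
    then have "(q, y) \<in> E'" using q(2,3) unfolding E' by blast
    then show False using q'(6) y by blast
  qed
  ultimately show ?thesis by blast
qed

theorem theorem7:
  fixes G :: "'a graph" and n r :: nat
  assumes "simple_graph G"
    and "k_connected (n + r + 2) G"
    and "toughness G > ereal (real (n + r + 2) / real (2 * (r + 2)))"
  shows "path_ge_factor_critical_avoidable 3 n G \<and>
    (\<forall>W e. W \<subseteq> verts G \<and> card W = n \<and> e \<in> edges (delete_verts G W) \<longrightarrow>
       (\<exists>F. path_ge_factor 3 F (delete_edge (delete_verts G W) e)))"
proof -
  have main: "\<exists>F. path_ge_factor 3 F (delete_edge (delete_verts G W) e)"
    if W: "W \<subseteq> verts G" "card W = n" and e: "e \<in> edges (delete_verts G W)" for W e
  proof -
    let ?V = "verts G - W" and ?E = "adj G" and ?H = "delete_edge (delete_verts G W) e"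
    have eG: "e \<in> edges G" "e \<subseteq> ?V"
      using e unfolding delete_verts_def induced_subgraph_def by auto
    have two: "\<And>e. e \<in> edges G \<Longrightarrow> card e = 2" and fin: "finite (verts G)"
      using assms(1) unfolding simple_graph_def by auto
    obtain u v where uv: "e = {u, v}" "u \<noteq> v" using two[OF eG(1)] by (auto simp: card_2_iff)
    have irr: "irrefl ?E" unfolding irrefl_def adj_def using two by fastforce
    have "card (verts G) = card ?V + n" using W fin card_Diff_subset[of W "verts G"]
      card_mono[OF fin W(1)] finite_subset[OF W(1) fin] by simp
    moreover have "n + r + 2 < card (verts G)" using assms(2) unfolding k_connected_def by blast
    \<comment> \<open>The definition of \<open>k_connected\<close> demands more than
      \<open>n + r + 2\<close> vertices, so at least \<open>r + 3\<close> remain outside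
      \<open>W\<close>.\<close>
    ultimately have "3 \<le> card ?V" by linarith
    moreover have "finite ?V" using fin by blast
    moreover have "u \<in> ?V" "v \<in> ?V" "(u, v) \<in> ?E" using eG uv unfolding adj_def by auto
    ultimately have fac: "fac (?E - {(u, v), (v, u)}) ?V"
      using few_comps[OF assms W] by (intro fac_delete_edge[OF sym_adj irr]) auto
    have VH: "verts ?H = ?V"
      unfolding delete_edge_def delete_verts_def induced_subgraph_def by auto
    have EH: "{x, y} \<in> edges ?H"
      if "x \<in> verts ?H" "y \<in> verts ?H" "(x, y) \<in> ?E - {(u, v), (v, u)}" for x y
      using that uv unfolding VH
      by (auto simp: delete_edge_def delete_verts_def induced_subgraph_def adj_def doubleton_eq_iff)
    obtain F where "path_ge_factor 3 F ?H"
      using fac_imp_path_ge_factor[of _ ?H, OF fac[folded VH] EH] .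
    then show ?thesis by blast
  qed
  moreover have "path_ge_factor_critical_avoidable 3 n G"
    unfolding path_ge_factor_critical_avoidable_def path_ge_factor_avoidable_def
  proof (intro allI impI ballI)
    fix W e assume "W \<subseteq> verts G \<and> card W = n" and e: "e \<in> edges (delete_verts G W)"
    then obtain F where F: "path_ge_factor 3 F (delete_edge (delete_verts G W) e)"
      using main by blast
    then have "path_ge_factor 3 F (delete_verts G W)" "e \<notin> edges F"
      unfolding path_ge_factor_def path_factor_def spanning_subgraph_def delete_edge_def by auto
    then show "\<exists>F. path_ge_factor 3 F (delete_verts G W) \<and> e \<notin> edges F" by blast
  qed
  ultimately show ?thesis by blast
qed

end
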